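(* There exists an opfibration from $\mathcal{G}_T$ to the Schreier graph $LN\text{-}\mathcal{S}(\Sigma_T)$; in particular, since $\mathcal{G}_T$ is finite, $\Sigma_T$ has finite index in $\Pi$.
   Context: Let $\Pi=\mathrm{PGL}_2\mathbb{Z}$, with $L=\begin{bmatrix}1&0\\1&1\end{bmatrix}$, $N=\begin{bmatrix}1&1\\0&1\end{bmatrix}$, $F=\begin{bmatrix}0&1\\1&0\end{bmatrix}$; let $\mathcal{M}$ be the free monoid generated by $L,N$ (the elements of $\mathrm{PSL}_2\mathbb{Z}$ with nonnegative entries). A slow continued fraction algorithm $T$ on $\Delta=[0,\infty]$ is given by a unimodular partition $\Delta_a=A_a*\Delta$ ($a=0,\dots,n-1$, $n\ge2$, listed left to right), where $A_a\in\Pi$ has nonnegative entries, and $T$ acts on $\Delta_a$ via $A_a^{-1}$. Write uniquely $A_a=B_aF^{e(a)}$ with $B_a\in\mathcal{M}$, $e(a)\in\{0,1\}$. $\Sigma_T$ is the subgroup of $\Pi$ generated by $A_0,\dots,A_{n-1}$. The graph $\mathcal{G}_T$: start from two copies of the binary tree of $\mathcal{M}$ (vertices $B\in\mathcal{M}$ with $L$- and $N$-edges $B\to BL$, $B\to BN$, and twin vertices $BF$ with edges $BF\to BFL=BNF$, $BF\to BFN=BLF$), joined by $F$-edges $B\leftrightarrow BF$; keep only the vertices $B,BF$ with $B$ a left factor in $\mathcal{M}$ of some $B_a$. The leaves are the $B_a$ and $B_aF$. For each $a$, if $e(a)=0$ glue $B_a$ to the root $1$ and $B_aF$ to the vertex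 $2$ (the $F$-neighbour of $1$); if $e(a)=1$ glue $B_a$ to $2$ and $B_aF$ to $1$. The result is a finite rooted graph with exactly one $L$-, $N$-, $F$-edge leaving each vertex. $LN\text{-}\mathcal{S}(\Sigma)$ is the Schreier graph of $\Sigma\le\Pi$ w.r.t. generators $\{L,N,F\}$: vertices are right cosets $\Sigma B$, root $\Sigma$, and an $X$-edge from $\Sigma B$ to $\Sigma BX$. An opfibration is a surjective homomorphism of rooted edge-labelled directed graphs which, for each vertex $y$, restricts to a bijection from the edges leaving $y$ to the edges leaving the image of $y$. *)

theory Defs
  imports "HOL-Analysis.Analysis" "HOL-Algebra.Coset" "HOL-Algebra.Generated_Groups"
    "Graph_Theory.Digraph"
begin

section \<open>The group PGL(2,Z)\<close>

definition GL2Z :: "(int^2^2) monoid" where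
  "GL2Z = \<lparr>carrier = {A. invertible A}, mult = (\<lambda>A B. A ** B), one = mat 1\<rparr>"

text \<open>Elements of \<open>\<Pi>\<close> are sets \<open>{A, -A}\<close>.\<close>

definition PGL2Z :: "(int^2^2) set monoid" (\<open>\<Pi>\<close>) where
  "\<Pi> = GL2Z Mod {mat 1, mat (-1)}"

definition proj :: "int^2^2 \<Rightarrow> (int^2^2) set" where
  "proj A = {mat 1, mat (-1)} #>\<^bsub>GL2Z\<^esub> A"

datatype label = L | N | F

fun gen :: "label \<Rightarrow> (int^2^2) set" where
  "gen L = proj (vector [vector [1, 0], vector [1, 1]])"
| "gen N = proj (vector [vector [1, 1], vector [0, 1]])"
| "gen F = proj (vector [vector [0, 1], vector [1, 0]])"

inductive_set LN_monoid :: "(int^2^2) set set" (\<open>\<M>\<close>) where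
  one: "\<one>\<^bsub>\<Pi>\<^esub> \<in> \<M>"
| L: "B \<in> \<M> \<Longrightarrow> B \<otimes>\<^bsub>\<Pi>\<^esub> gen L \<in> \<M>"
| N: "B \<in> \<M> \<Longrightarrow> B \<otimes>\<^bsub>\<Pi>\<^esub> gen N \<in> \<M>"

definition left_factor :: "(int^2^2) set \<Rightarrow> (int^2^2) set \<Rightarrow> bool" where
  "left_factor B C \<longleftrightarrow> (\<exists>D\<in>\<M>. C = B \<otimes>\<^bsub>\<Pi>\<^esub> D)"

definition nonneg_entries :: "(int^2^2) set \<Rightarrow> bool" where
  "nonneg_entries P \<longleftrightarrow> (\<exists>A\<in>P. \<forall>i j. A $ i $ j \<ge> 0)"


section \<open>Slow continued fraction algorithms\<close>

text \<open>The projective line is modelled inside \<^typ>\<open>ereal\<close>, with both infinities read as the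
  single point at infinity. This makes \<open>\<Delta>\<close> the interval \<open>{0..\<infinity>}\<close> with its usual order;
  elements of \<open>\<Pi>\<close> with nonnegative entries map \<open>\<Delta>\<close> into \<open>\<Delta>\<close>.\<close>

definition moebius :: "int^2^2 \<Rightarrow> ereal \<Rightarrow> ereal" where
  "moebius A x =
    (let a = real_of_int (A$1$1); b = real_of_int (A$1$2);
         c = real_of_int (A$2$1); d = real_of_int (A$2$2); t = real_of_ereal x
     in if \<bar>x\<bar> = \<infinity> then (if c = 0 then \<infinity> else ereal (a / c))
        else if c * t + d = 0 then \<infinity> else ereal ((a * t + b) / (c * t + d)))"

text \<open>Both representatives of an element of \<open>\<Pi>\<close> induce the same map.\<close>

definition act :: "(int^2^2) set \<Rightarrow> ereal \<Rightarrow> ereal" where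
  "act P x = the_elem ((\<lambda>A. moebius A x) ` P)"

definition Delta :: "ereal set" (\<open>\<Delta>\<close>) where
  "\<Delta> = {0..\<infinity>}"

text \<open>An algorithm is given by its family \<open>A 0, \<dots>, A (n - 1)\<close>; it acts on the interval
  \<open>act (A a) ` \<Delta>\<close> as the inverse of \<open>act (A a)\<close>.
  Values of \<open>A\<close> at arguments \<open>\<ge> n\<close> are irrelevant.\<close>

definition slow_cf :: "nat \<Rightarrow> (nat \<Rightarrow> (int^2^2) set) \<Rightarrow> bool" where
  "slow_cf n A \<longleftrightarrow> 2 \<le> n
    \<and> (\<forall>a<n. A a \<in> carrier \<Pi> \<and> nonneg_entries (A a))
    \<and> (\<Union>a<n. act (A a) ` \<Delta>) = \<Delta>
    \<and> (\<forall>a<n. \<forall>b<n. a \<noteq> b \<longrightarrow> interior (act (A a) ` \<Delta>) \<inter> interior (act (A b) ` \<Delta>) = {})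
    \<and> (\<forall>a<n. \<forall>b<n. a < b \<longrightarrow> (\<forall>x \<in> act (A a) ` \<Delta>. \<forall>y \<in> act (A b) ` \<Delta>. x \<le> y))"

definition Sigma_T :: "nat \<Rightarrow> (nat \<Rightarrow> (int^2^2) set) \<Rightarrow> (int^2^2) set set" where
  "Sigma_T n A = generate \<Pi> (A ` {..<n})"

text \<open>The unique factorization \<open>P = B F\<^sup>e\<close> with \<open>B \<in> \<M>\<close> and \<open>e \<in> {0, 1}\<close>, available for
  every \<open>P \<in> \<Pi>\<close> with nonnegative entries.\<close>

definition B_part :: "(int^2^2) set \<Rightarrow> (int^2^2) set" where
  "B_part P = (THE B. B \<in> \<M> \<and> (\<exists>e\<in>{0, 1::nat}. P = B \<otimes>\<^bsub>\<Pi>\<^esub> (gen F [^]\<^bsub>\<Pi>\<^esub> e)))"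

definition e_part :: "(int^2^2) set \<Rightarrow> nat" where
  "e_part P = (THE e. e \<in> {0, 1} \<and> (\<exists>B\<in>\<M>. P = B \<otimes>\<^bsub>\<Pi>\<^esub> (gen F [^]\<^bsub>\<Pi>\<^esub> e)))"


section \<open>Rooted edge-labelled directed graphs\<close>

record ('v, 'e, 'l) rooted_lgraph =
  digr :: "('v, 'e) pre_digraph"
  root :: 'v
  lab :: "'e \<Rightarrow> 'l"

definition rooted_lgraph :: "('v, 'e, 'l) rooted_lgraph \<Rightarrow> bool" where
  "rooted_lgraph G \<longleftrightarrow> wf_digraph (digr G) \<and> root G \<in> verts (digr G)"

definition lgraph_hom ::
    "('v, 'e, 'l) rooted_lgraph \<Rightarrow> ('w, 'f, 'l) rooted_lgraph \<Rightarrow> ('v \<Rightarrow> 'w) \<Rightarrow> ('e \<Rightarrow> 'f) \<Rightarrow> bool" where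
  "lgraph_hom G H \<phi> \<psi> \<longleftrightarrow> rooted_lgraph G \<and> rooted_lgraph H
    \<and> \<phi> ` verts (digr G) \<subseteq> verts (digr H)
    \<and> \<psi> ` arcs (digr G) \<subseteq> arcs (digr H)
    \<and> (\<forall>e\<in>arcs (digr G). tail (digr H) (\<psi> e) = \<phi> (tail (digr G) e)
          \<and> head (digr H) (\<psi> e) = \<phi> (head (digr G) e)
          \<and> lab H (\<psi> e) = lab G e)
    \<and> \<phi> (root G) = root H"

definition opfibration ::
    "('v, 'e, 'l) rooted_lgraph \<Rightarrow> ('w, 'f, 'l) rooted_lgraph \<Rightarrow> ('v \<Rightarrow> 'w) \<Rightarrow> ('e \<Rightarrow> 'f) \<Rightarrow> bool" where
  "opfibration G H \<phi> \<psi> \<longleftrightarrow> lgraph_hom G H \<phi> \<psi>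
    \<and> \<phi> ` verts (digr G) = verts (digr H)
    \<and> \<psi> ` arcs (digr G) = arcs (digr H)
    \<and> (\<forall>y\<in>verts (digr G). bij_betw \<psi> (out_arcs (digr G) y) (out_arcs (digr H) (\<phi> y)))"

text \<open>In all graphs below an edge is determined by its source, label and target.\<close>

definition triple_graph ::
    "'v set \<Rightarrow> ('v \<times> 'l \<times> 'v) set \<Rightarrow> 'v \<Rightarrow> ('v, 'v \<times> 'l \<times> 'v, 'l) rooted_lgraph" where
  "triple_graph V E r =
    \<lparr>digr = \<lparr>verts = V, arcs = E, tail = (\<lambda>(u, X, v). u), head = (\<lambda>(u, X, v). v)\<rparr>,
     root = r, lab = (\<lambda>(u, X, v). X)\<rparr>"


section \<open>The graph of an algorithm and the Schreier graph\<close>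

text \<open>The two copies of the binary tree of \<open>\<M>\<close>, joined by \<open>F\<close>-edges. For the twin vertices,
  \<open>BFL = BNF\<close> and \<open>BFN = BLF\<close> are again twin vertices.\<close>

definition double_tree_verts :: "(int^2^2) set set" where
  "double_tree_verts = \<M> \<union> {B \<otimes>\<^bsub>\<Pi>\<^esub> gen F | B. B \<in> \<M>}"

definition double_tree_edges :: "((int^2^2) set \<times> label \<times> (int^2^2) set) set" where
  "double_tree_edges = {(v, X, v \<otimes>\<^bsub>\<Pi>\<^esub> gen X) | v X. v \<in> double_tree_verts}"

definition kept_verts :: "nat \<Rightarrow> (nat \<Rightarrow> (int^2^2) set) \<Rightarrow> (int^2^2) set set" where
  "kept_verts n A =
    (let K = {B \<in> \<M>. \<exists>a<n. left_factor B (B_part (A a))}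
     in K \<union> {B \<otimes>\<^bsub>\<Pi>\<^esub> gen F | B. B \<in> K})"

definition kept_edges :: "nat \<Rightarrow> (nat \<Rightarrow> (int^2^2) set) \<Rightarrow> ((int^2^2) set \<times> label \<times> (int^2^2) set) set" where
  "kept_edges n A = {(u, X, v) \<in> double_tree_edges. u \<in> kept_verts n A \<and> v \<in> kept_verts n A}"

text \<open>The vertex called 2 is \<open>gen F\<close>, the \<open>F\<close>-neighbour of the root \<open>\<one>\<close>.\<close>

definition glue :: "nat \<Rightarrow> (nat \<Rightarrow> (int^2^2) set) \<Rightarrow> (int^2^2) set rel" where
  "glue n A =
    (\<Union>a<n. if e_part (A a) = 0
       then {(B_part (A a), \<one>\<^bsub>\<Pi>\<^esub>), (B_part (A a) \<otimes>\<^bsub>\<Pi>\<^esub> gen F, gen F)}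
       else {(B_part (A a), gen F), (B_part (A a) \<otimes>\<^bsub>\<Pi>\<^esub> gen F, \<one>\<^bsub>\<Pi>\<^esub>)})"

definition glue_equiv :: "nat \<Rightarrow> (nat \<Rightarrow> (int^2^2) set) \<Rightarrow> (int^2^2) set rel" where
  "glue_equiv n A = (glue n A \<union> (glue n A)\<inverse>)\<^sup>*"

text \<open>Vertices are gluing classes; edges with the same label and the same glued endpoints (such as
  the \<open>F\<close>-edges at the leaves and at the root) become one edge.\<close>

definition graph_T :: "nat \<Rightarrow> (nat \<Rightarrow> (int^2^2) set) \<Rightarrow>
    ((int^2^2) set set, (int^2^2) set set \<times> label \<times> (int^2^2) set set, label) rooted_lgraph" where
  "graph_T n A =
    (let cls = (\<lambda>v. glue_equiv n A `` {v})
     in triple_graph (kept_verts n A // glue_equiv n A)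
          {(cls u, X, cls v) | u X v. (u, X, v) \<in> kept_edges n A}
          (cls \<one>\<^bsub>\<Pi>\<^esub>))"

definition schreier :: "(int^2^2) set set \<Rightarrow>
    ((int^2^2) set set, (int^2^2) set set \<times> label \<times> (int^2^2) set set, label) rooted_lgraph" where
  "schreier S =
    triple_graph (rcosets\<^bsub>\<Pi>\<^esub> S)
      {(S #>\<^bsub>\<Pi>\<^esub> B, X, S #>\<^bsub>\<Pi>\<^esub> (B \<otimes>\<^bsub>\<Pi>\<^esub> gen X)) | B X. B \<in> carrier \<Pi>}
      S"

end

theory Submission
  imports Defs
begin

text \<open>An element of \<open>\<M>\<close> is a unique word in L and N, and two words are prefix-comparable as soon as
  their images of the open interval from 0 to infinity meet. The partition property therefore says
  that the words of the \<open>B\<^sub>a\<close> form a complete prefix code, so every kept vertex that is not a leaf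
  has all its L-, N- and F-neighbours. Gluing is the retraction sending \<open>A\<^sub>a\<close> to 1 and \<open>A\<^sub>a F\<close> to F,
  so each gluing class has exactly one edge with each label, and \<open>v \<mapsto> \<Sigma> v\<close> respects gluing since
  \<open>A\<^sub>a \<in> \<Sigma>\<close>. Its image is a finite set of cosets closed under the injective right action of L, N
  and F, hence also under the inverses of these generators of \<open>\<Pi>\<close>, so it contains all cosets.\<close>

section \<open>Two-by-two integer matrices\<close>

abbreviation mat2 :: "int \<Rightarrow> int \<Rightarrow> int \<Rightarrow> int \<Rightarrow> int^2^2" where
  "mat2 a b c d \<equiv> vector [vector [a, b], vector [c, d]]"

lemma mat2_expand: "A = mat2 (A$1$1) (A$1$2) (A$2$1) (A$2$2)"
  by (simp add: vec_eq_iff forall_2)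

lemma mat2_cases: obtains a b c d where "A = mat2 a b c d"
  using mat2_expand by blast

lemma mat2_eq_iff [simp]:
  "mat2 a b c d = mat2 a' b' c' d' \<longleftrightarrow> a = a' \<and> b = b' \<and> c = c' \<and> d = d'"
  by (auto simp: vec_eq_iff forall_2)

lemma mat2_mult [simp]:
  "mat2 a b c d ** mat2 a' b' c' d' =
    mat2 (a*a' + b*c') (a*b' + b*d') (c*a' + d*c') (c*b' + d*d')"
  by (simp add: vec_eq_iff forall_2 matrix_matrix_mult_def sum_2)

lemma mat2_uminus [simp]: "- mat2 a b c d = mat2 (-a) (-b) (-c) (-d)"
  by (simp add: vec_eq_iff forall_2)

lemma mat_eq_mat2: "(mat k :: int^2^2) = mat2 k 0 0 k"
  by (simp add: vec_eq_iff forall_2 mat_def)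

lemma det_mat2 [simp]: "det (mat2 a b c d) = a*d - b*c"
  by (simp add: det_2)

text \<open>Over the integers the only units are 1 and -1. Conversely the adjugate, corrected by the
  sign of the determinant, is an integral inverse.\<close>

lemma invertible_mat2: "invertible (mat2 a b c d) \<longleftrightarrow> \<bar>a*d - b*c\<bar> = 1"
proof
  assume "invertible (mat2 a b c d)"
  then obtain B where "mat2 a b c d ** B = mat 1" by (auto simp: invertible_def)
  then have "det (mat2 a b c d) * det B = 1" by (metis det_I det_mul)
  then have "(a*d - b*c) * det B = 1" by simp
  then show "\<bar>a*d - b*c\<bar> = 1" by (metis abs_zmult_eq_1 abs_one)
next
  assume *: "\<bar>a*d - b*c\<bar> = 1"
  \<comment> \<open>Being 1 or -1, the determinant \<open>k\<close> is its own inverse, so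
    \<open>k\<close> times the adjugate inverts the matrix without any division.\<close>
  define k where "k = a*d - b*c"
  have "k * k = 1" using * unfolding k_def by (metis abs_mult_self_eq mult_1)
  then have k: "k * (a*d - b*c) = 1" by (simp only: flip: k_def)
  let ?B = "mat2 (k*d) (-(k*b)) (-(k*c)) (k*a)"
  have "mat2 a b c d ** ?B = mat 1" "?B ** mat2 a b c d = mat 1"
    using k by (simp_all add: mat_eq_mat2 algebra_simps)
  then show "invertible (mat2 a b c d)" unfolding invertible_def by blast
qed

lemma invertible_mat_1: "invertible (mat 1 :: int^2^2)"
  by (simp add: mat_eq_mat2 invertible_mat2)

section \<open>The quotient group and multiplication by its generators\<close>

lemma group_GL2Z: "group GL2Z"
proof (rule groupI)
  fix A assume "A \<in> carrier GL2Z"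
  then show "\<exists>B\<in>carrier GL2Z. B \<otimes>\<^bsub>GL2Z\<^esub> A = \<one>\<^bsub>GL2Z\<^esub>"
    unfolding GL2Z_def invertible_def by simp blast
qed (auto simp: GL2Z_def invertible_mult matrix_mul_assoc invertible_mat_1)

lemma mult_mat_minus_1: "mat (-1) ** A = - A" "A ** mat (-1) = - (A :: int^2^2)"
  by (cases A rule: mat2_cases, simp add: mat_eq_mat2)+

lemma proj_eq: "proj A = {A, - A}"
  by (auto simp: proj_def r_coset_def GL2Z_def mult_mat_minus_1)

text \<open>Both scalar matrices are central, so left and right cosets coincide, and each is its own
  inverse.\<close>

lemma normal_pm1: "{mat 1, mat (-1)} \<lhd> GL2Z"
proof (rule group.normalI[OF group_GL2Z])
  interpret group GL2Z by (rule group_GL2Z)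
  show "subgroup {mat 1, mat (-1)} GL2Z"
  proof (rule subgroupI)
    fix a :: "int^2^2" assume a: "a \<in> {mat 1, mat (- 1)}"
    then have "inv\<^bsub>GL2Z\<^esub> a = a"
      by (intro inv_equality) (auto simp: GL2Z_def mat_eq_mat2 invertible_mat2)
    then show "inv\<^bsub>GL2Z\<^esub> a \<in> {mat 1, mat (- 1)}" using a by simp
  qed (auto simp: GL2Z_def mat_eq_mat2 invertible_mat2)
  show "\<forall>x\<in>carrier GL2Z. {mat 1, mat (- 1)} #>\<^bsub>GL2Z\<^esub> x = x <#\<^bsub>GL2Z\<^esub> {mat 1, mat (- 1)}"
    by (auto simp: r_coset_def l_coset_def GL2Z_def mult_mat_minus_1)
qed

lemma group_PGL2Z: "group \<Pi>"
  unfolding PGL2Z_def by (rule normal.factorgroup_is_group[OF normal_pm1])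

interpretation PGL2Z: group \<Pi> by (rule group_PGL2Z)

lemma proj_mult:
  "invertible A \<Longrightarrow> invertible B \<Longrightarrow> proj A \<otimes>\<^bsub>\<Pi>\<^esub> proj B = proj (A ** B)"
  using normal.rcos_sum[OF normal_pm1, of A B]
  by (simp add: proj_def PGL2Z_def FactGroup_def GL2Z_def)

lemma one_PGL2Z: "\<one>\<^bsub>\<Pi>\<^esub> = proj (mat2 1 0 0 1)"
  by (simp add: proj_eq PGL2Z_def FactGroup_def mat_eq_mat2)

lemma carrier_PGL2Z: "carrier \<Pi> = proj ` {A. invertible A}"
  by (auto simp: PGL2Z_def FactGroup_def RCOSETS_def proj_def GL2Z_def)

lemma proj_mat2_closed: "\<bar>a*d - b*c\<bar> = 1 \<Longrightarrow> proj (mat2 a b c d) \<in> carrier \<Pi>"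
  by (auto simp: carrier_PGL2Z invertible_mat2)

lemma PGL2Z_cases:
  assumes "P \<in> carrier \<Pi>"
  obtains a b c d where "P = proj (mat2 a b c d)" "\<bar>a*d - b*c\<bar> = 1"
  using assms by (auto simp: carrier_PGL2Z) (metis mat2_cases invertible_mat2)

lemma gen_closed [simp]: "gen X \<in> carrier \<Pi>"
  by (cases X) (simp_all add: proj_mat2_closed)

text \<open>Column operations: L adds the second column to the first, N the first to the second, and
  F swaps them. On the left, the generators act on rows in the same manner.\<close>

lemma proj_mult_gen:
  assumes "\<bar>a*d - b*c\<bar> = 1"
  shows "proj (mat2 a b c d) \<otimes>\<^bsub>\<Pi>\<^esub> gen L = proj (mat2 (a+b) b (c+d) d)"
    "proj (mat2 a b c d) \<otimes>\<^bsub>\<Pi>\<^esub> gen N = proj (mat2 a (a+b) c (c+d))"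
    "proj (mat2 a b c d) \<otimes>\<^bsub>\<Pi>\<^esub> gen F = proj (mat2 b a d c)"
  using assms by (simp_all add: proj_mult invertible_mat2)

lemma gen_mult_proj:
  assumes "\<bar>a*d - b*c\<bar> = 1"
  shows "gen L \<otimes>\<^bsub>\<Pi>\<^esub> proj (mat2 a b c d) = proj (mat2 a b (a+c) (b+d))"
    "gen N \<otimes>\<^bsub>\<Pi>\<^esub> proj (mat2 a b c d) = proj (mat2 (a+c) (b+d) c d)"
    "gen F \<otimes>\<^bsub>\<Pi>\<^esub> proj (mat2 a b c d) = proj (mat2 c d a b)"
  using assms by (simp_all add: proj_mult invertible_mat2)

lemma gen_relations:
  "gen F \<otimes>\<^bsub>\<Pi>\<^esub> gen F = \<one>\<^bsub>\<Pi>\<^esub>"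
  "gen F \<otimes>\<^bsub>\<Pi>\<^esub> gen L = gen N \<otimes>\<^bsub>\<Pi>\<^esub> gen F"
  "gen F \<otimes>\<^bsub>\<Pi>\<^esub> gen N = gen L \<otimes>\<^bsub>\<Pi>\<^esub> gen F"
  by (simp_all add: proj_mult invertible_mat2 one_PGL2Z)

lemma mult_F_F [simp]: "P \<in> carrier \<Pi> \<Longrightarrow> P \<otimes>\<^bsub>\<Pi>\<^esub> gen F \<otimes>\<^bsub>\<Pi>\<^esub> gen F = P"
  by (simp add: PGL2Z.m_assoc gen_relations del: gen.simps)

declare gen_relations(1) [simp] gen.simps [simp del]

section \<open>Words\<close>

definition word :: "label list \<Rightarrow> (int^2^2) set" where
  "word w = foldr (\<lambda>X P. gen X \<otimes>\<^bsub>\<Pi>\<^esub> P) w \<one>\<^bsub>\<Pi>\<^esub>"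

lemma word_simps [simp]:
  "word [] = \<one>\<^bsub>\<Pi>\<^esub>" "word (X # w) = gen X \<otimes>\<^bsub>\<Pi>\<^esub> word w"
  by (simp_all add: word_def)

lemma word_closed [simp]: "word w \<in> carrier \<Pi>"
  by (induction w) auto

lemma word_append: "word (u @ v) = word u \<otimes>\<^bsub>\<Pi>\<^esub> word v"
  by (induction u) (auto simp: PGL2Z.m_assoc)

text \<open>The inductive definition appends letters on the right while \<open>word\<close>
  multiplies from the left, hence the reversed induction in the converse direction.\<close>

lemma LN_monoid_iff_word: "B \<in> \<M> \<longleftrightarrow> (\<exists>w. B = word w \<and> set w \<subseteq> {L, N})"
proof
  assume "B \<in> \<M>"
  then show "\<exists>w. B = word w \<and> set w \<subseteq> {L, N}"
  proof induction
    case one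
    show ?case by (intro exI[of _ "[]"]) auto
  next
    case (L B)
    then obtain w where "B = word w" "set w \<subseteq> {L, N}" by blast
    then show ?case by (intro exI[of _ "w @ [L]"]) (auto simp: word_append)
  next
    case (N B)
    then obtain w where "B = word w" "set w \<subseteq> {L, N}" by blast
    then show ?case by (intro exI[of _ "w @ [N]"]) (auto simp: word_append)
  qed
next
  assume "\<exists>w. B = word w \<and> set w \<subseteq> {L, N}"
  then obtain w where "B = word w" "set w \<subseteq> {L, N}" by blast
  then show "B \<in> \<M>"
  proof (induction w arbitrary: B rule: rev_induct)
    case Nil
    then show ?case by (simp add: LN_monoid.one)
  next
    case (snoc X w)
    then show ?case by (auto simp: word_append intro: LN_monoid.L LN_monoid.N)
  qed
qed

section \<open>Determinants and the unique factorization of nonnegative elements\<close>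

lemma LN_monoid_closed [simp]: "B \<in> \<M> \<Longrightarrow> B \<in> carrier \<Pi>"
  by (auto simp: LN_monoid_iff_word)

text \<open>L and N have determinant 1, and negating a two-by-two matrix leaves its determinant
  unchanged, so the choice of representative does not matter.\<close>

lemma LN_monoid_det: "B \<in> \<M> \<Longrightarrow> A \<in> B \<Longrightarrow> det A = 1"
proof -
  have "\<exists>a b c d. word w = proj (mat2 a b c d) \<and> a*d - b*c = 1" if "set w \<subseteq> {L, N}" for w
    using that
  proof (induction w)
    case Nil
    show ?case by (intro exI[of _ 1] exI[of _ 0]) (simp_all add: one_PGL2Z)
  next
    case (Cons X w)
    then obtain a b c d where w: "word w = proj (mat2 a b c d)" "a*d - b*c = 1" by auto
    show ?case
    proof (cases "X = L")
      case True
      show ?thesis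
        by (intro exI[of _ a] exI[of _ b] exI[of _ "a+c"] exI[of _ "b+d"])
           (use w True in \<open>auto simp: gen_mult_proj algebra_simps\<close>)
    next
      case False
      then have "X = N" using Cons.prems by auto
      then show ?thesis
        by (intro exI[of _ "a+c"] exI[of _ "b+d"] exI[of _ c] exI[of _ d])
           (use w in \<open>auto simp: gen_mult_proj algebra_simps\<close>)
    qed
  qed
  then show "B \<in> \<M> \<Longrightarrow> A \<in> B \<Longrightarrow> det A = 1"
    by (fastforce simp: LN_monoid_iff_word proj_eq)
qed

text \<open>The factor F turns determinant 1 into -1.\<close>

lemma LN_monoid_mult_F:
  assumes "B \<in> \<M>"
  shows "B \<otimes>\<^bsub>\<Pi>\<^esub> gen F \<notin> \<M>"
proof
  assume *: "B \<otimes>\<^bsub>\<Pi>\<^esub> gen F \<in> \<M>"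
  from assms have "B \<in> carrier \<Pi>" by simp
  then obtain a b c d where B: "B = proj (mat2 a b c d)" "\<bar>a*d - b*c\<bar> = 1"
    by (rule PGL2Z_cases)
  from LN_monoid_det[OF assms, of "mat2 a b c d"] B have 1: "a*d - b*c = 1" by (simp add: proj_eq)
  from LN_monoid_det[OF *, of "mat2 b a d c"] B have "b*c - a*d = 1"
    by (simp add: proj_mult_gen) (simp add: proj_eq)
  with 1 show False by simp
qed

text \<open>Subtractive Euclidean algorithm on columns: whenever one column dominates the other,
  subtracting the smaller one splits off a letter L or N on the right and lowers the sum of the
  entries.\<close>

lemma nonneg_det_1_in_LN_monoid:
  assumes "a \<ge> 0" "b \<ge> 0" "c \<ge> 0" "d \<ge> 0" "a*d - b*c = 1"
  shows "proj (mat2 a b c d) \<in> \<M>"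
  using assms
proof (induction "nat (a + b + c + d)" arbitrary: a b c d rule: less_induct)
  case less
  \<comment> \<open>A zero column would make the determinant vanish. Hence the subtracted column has
    positive sum, which gives the descent.\<close>
  have "\<not> (b = 0 \<and> d = 0)" "\<not> (a = 0 \<and> c = 0)" using less.prems(5) by auto
  then have bd: "b + d > 0" and ac: "a + c > 0" using less.prems by linarith+
  consider "a \<ge> b" "c \<ge> d" | "b \<ge> a" "d \<ge> c" | "a > b" "d > c" | "b > a" "c > d" by linarith
  then show ?case
  proof cases
    case 1
    have "(a - b) * d - b * (c - d) = 1" using less.prems by (simp add: algebra_simps)
    then have "proj (mat2 (a - b) b (c - d) d) \<in> \<M>"
      using less.prems(1-4) bd 1 by (intro less.hyps; (assumption | simp))
    from LN_monoid.L[OF this] show ?thesis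
      using \<open>(a - b) * d - b * (c - d) = 1\<close> by (simp add: proj_mult_gen)
  next
    case 2
    have "a * (d - c) - (b - a) * c = 1" using less.prems by (simp add: algebra_simps)
    then have "proj (mat2 a (b - a) c (d - c)) \<in> \<M>"
      using less.prems(1-4) ac 2 by (intro less.hyps; (assumption | simp))
    from LN_monoid.N[OF this] show ?thesis
      using \<open>a * (d - c) - (b - a) * c = 1\<close> by (simp add: proj_mult_gen)
  next
    case 3
    \<comment> \<open>Here \<open>a * d\<close> is at least \<open>b * c + b + c + 1\<close>, and
      determinant 1 leaves no room for positive \<open>b\<close> or \<open>c\<close>: the matrix is
      the identity.\<close>
    then have "(b + 1) * (c + 1) \<le> a * d" using less.prems by (intro mult_mono) auto
    then have "b = 0" "c = 0" using less.prems by (auto simp: algebra_simps)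
    moreover have "a = 1" "d = 1"
      using less.prems \<open>b = 0\<close> by (auto simp: zmult_eq_1_iff)
    ultimately show ?thesis using LN_monoid.one by (simp add: one_PGL2Z)
  next
    case 4
    \<comment> \<open>This would force a determinant of at most 0, so the case is
      impossible.\<close>
    then have "a * d \<le> b * c" using less.prems by (intro mult_mono) auto
    then show ?thesis using less.prems by simp
  qed
qed

lemma nonneg_entries_cases:
  assumes "P \<in> carrier \<Pi>" "nonneg_entries P"
  obtains a b c d where "P = proj (mat2 a b c d)" "\<bar>a*d - b*c\<bar> = 1"
    "a \<ge> 0" "b \<ge> 0" "c \<ge> 0" "d \<ge> 0"
proof -
  obtain M where M: "M \<in> P" "\<And>i j. M $ i $ j \<ge> 0"
    using assms(2) by (auto simp: nonneg_entries_def)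
  obtain a b c d where P: "P = proj (mat2 a b c d)" "\<bar>a*d - b*c\<bar> = 1"
    using assms(1) by (rule PGL2Z_cases)
  \<comment> \<open>The nonnegative \<open>M\<close> is the chosen matrix or its negative, so it
    represents the same class and has the same determinant.\<close>
  have "P = proj M" using M(1) P(1) by (auto simp: proj_eq)
  moreover have "\<bar>M$1$1 * M$2$2 - M$1$2 * M$2$1\<bar> = 1"
    using M(1) P by (auto simp: proj_eq)
  ultimately show ?thesis using that M(2) mat2_expand by metis
qed

text \<open>The sign of the determinant decides: F swaps the columns, which keeps the entries
  nonnegative and negates the determinant.\<close>

lemma nonneg_factorization:
  assumes "P \<in> carrier \<Pi>" "nonneg_entries P"
  shows "P \<in> \<M> \<or> P \<otimes>\<^bsub>\<Pi>\<^esub> gen F \<in> \<M>"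
proof -
  obtain a b c d where P: "P = proj (mat2 a b c d)" "\<bar>a*d - b*c\<bar> = 1"
    "a \<ge> 0" "b \<ge> 0" "c \<ge> 0" "d \<ge> 0"
    using assms by (rule nonneg_entries_cases)
  have "a*d - b*c = 1 \<or> b*c - a*d = 1" using P(2) by linarith
  then show ?thesis
    using nonneg_det_1_in_LN_monoid[of a b c d] nonneg_det_1_in_LN_monoid[of b a d c] P
    by (auto simp: proj_mult_gen)
qed

text \<open>Both definite descriptions are well defined, because two factorizations with different
  exponents would put some \<open>B\<close> and its product with F into the monoid at once.\<close>

lemma B_part_e_part:
  assumes "B \<in> \<M>" "e \<in> {0, 1}" "P = B \<otimes>\<^bsub>\<Pi>\<^esub> (gen F [^]\<^bsub>\<Pi>\<^esub> e)"
  shows "B_part P = B" "e_part P = e"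
proof -
  have *: "B' = B \<and> e' = e"
    if "B' \<in> \<M>" "e' \<in> {0, 1}" "P = B' \<otimes>\<^bsub>\<Pi>\<^esub> (gen F [^]\<^bsub>\<Pi>\<^esub> e')" for B' e'
    using that assms LN_monoid_mult_F[of B] LN_monoid_mult_F[of B'] by auto
  show "B_part P = B" unfolding B_part_def
    by (rule the_equality, use assms in blast) (elim conjE bexE, use * in simp)
  show "e_part P = e" unfolding e_part_def
    by (rule the_equality, use assms in blast) (elim conjE bexE, use * in simp)
qed

lemma B_part_e_part_LN:
  assumes "P \<in> \<M>"
  shows "B_part P = P" "e_part P = 0"
  using B_part_e_part[of P 0 P] assms by simp_all

lemma B_part_e_part_LN_F:
  assumes "P \<in> carrier \<Pi>" "P \<otimes>\<^bsub>\<Pi>\<^esub> gen F \<in> \<M>"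
  shows "B_part P = P \<otimes>\<^bsub>\<Pi>\<^esub> gen F" "e_part P = 1"
  using B_part_e_part[of "P \<otimes>\<^bsub>\<Pi>\<^esub> gen F" 1 P] assms by simp_all

lemma B_part_in_LN_monoid:
  assumes "P \<in> carrier \<Pi>" "nonneg_entries P"
  shows "B_part P \<in> \<M>"
  using nonneg_factorization[OF assms]
proof
  assume "P \<in> \<M>"
  then show ?thesis using B_part_e_part_LN(1)[of P] by simp
next
  assume "P \<otimes>\<^bsub>\<Pi>\<^esub> gen F \<in> \<M>"
  then show ?thesis using B_part_e_part_LN_F(1)[OF assms(1)] by simp
qed


section \<open>Action on the positive reals\<close>

text \<open>Numerator and denominator change sign together, so both representatives give one value
  and \<open>the_elem\<close> is applied to a singleton.\<close>

lemma act_proj: "act (proj M) x = moebius M x"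
proof -
  have neg: "(- p - q) / (- r - s) = (p + q) / (r + s)" for p q r s :: real
    using minus_divide_divide[of "p + q" "r + s"] by simp
  have "moebius (- M) x = moebius M x"
  proof (cases M rule: mat2_cases)
    case (1 a b c d)
    show ?thesis
      using neg[of _ _ 0] by (simp add: 1 moebius_def Let_def neg)
  qed
  then show ?thesis by (simp add: act_def proj_eq)
qed

text \<open>These are the Moebius maps of the generators on the positive reals. They preserve
  positivity, so neither poles nor the point at infinity occur.\<close>

fun step :: "label \<Rightarrow> real \<Rightarrow> real" where
  "step L t = t / (t + 1)"
| "step N t = t + 1"
| "step F t = 1 / t"

lemma step_pos: "t > 0 \<Longrightarrow> step X t > 0"
  by (cases X) auto

lemma foldr_step_pos: "t > 0 \<Longrightarrow> foldr step w t > 0"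
  by (induction w) (auto simp: step_pos)

lemma step_inj: "step X s = step X t \<Longrightarrow> s > 0 \<Longrightarrow> t > 0 \<Longrightarrow> s = t"
  by (cases X) (auto simp: field_simps)

lemma foldr_step_inj: "foldr step w s = foldr step w t \<Longrightarrow> s > 0 \<Longrightarrow> t > 0 \<Longrightarrow> s = t"
  by (induction w) (auto dest!: step_inj simp: foldr_step_pos)

text \<open>A composition law at points whose first image is finite and positive, where the
  denominator of the second map cannot vanish.\<close>

lemma act_gen_mult:
  assumes P: "P \<in> carrier \<Pi>" and act: "act P (ereal t) = ereal s" and s: "s > 0"
  shows "act (gen X \<otimes>\<^bsub>\<Pi>\<^esub> P) (ereal t) = ereal (step X s)"
proof -
  obtain a b c d where abcd: "P = proj (mat2 a b c d)" "\<bar>a*d - b*c\<bar> = 1"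
    using P by (rule PGL2Z_cases)
  \<comment> \<open>Numerator and denominator of the image of \<open>t\<close> under
    \<open>P\<close>; finiteness of the value \<open>s\<close> shows that \<open>q\<close> is
    nonzero and that \<open>p = s * q\<close>.\<close>
  define p q where "p = a*t + b" and "q = c*t + d"
  have "(if q = 0 then \<infinity> else ereal (p / q)) = ereal s"
    using act by (simp add: abcd(1) act_proj moebius_def Let_def p_def q_def split: if_splits)
  then have q: "q \<noteq> 0" and "s = p / q" by (auto split: if_splits)
  then have p: "p = s * q" by simp
  show ?thesis
  proof (cases X)
    case L
    have den: "(a + c) * t + (b + d) = q * (s + 1)"
      using p by (simp add: p_def q_def algebra_simps)
    show ?thesis using L q s p den abcd
      by (simp add: gen_mult_proj act_proj moebius_def Let_def flip: p_def)
  next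
    case N
    have num: "(a + c) * t + (b + d) = q * (s + 1)"
      using p by (simp add: p_def q_def algebra_simps)
    show ?thesis using N q s p num abcd
      by (simp add: gen_mult_proj act_proj moebius_def Let_def flip: q_def)
  next
    case F
    show ?thesis using F q s p abcd
      by (simp add: gen_mult_proj act_proj moebius_def Let_def flip: p_def q_def)
  qed
qed

lemma act_word: "t > 0 \<Longrightarrow> act (word w) (ereal t) = ereal (foldr step w t)"
proof (induction w)
  case Nil
  then show ?case by (simp add: one_PGL2Z act_proj moebius_def)
next
  case (Cons X w)
  then show ?case by (simp add: act_gen_mult foldr_step_pos)
qed

text \<open>The letters L and N map the positive reals below and above 1, respectively, so the first
  letter at which two words differ separates their images.\<close>

lemma foldr_step_prefix:
  assumes "set u \<subseteq> {L, N}" "set v \<subseteq> {L, N}" "s > 0" "t > 0" "foldr step u s = foldr step v t"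
  shows "(\<exists>x. v = u @ x) \<or> (\<exists>x. u = v @ x)"
  using assms
proof (induction u arbitrary: v)
  case (Cons X u)
  show ?case
  proof (cases v)
    case v: (Cons Y v')
    have pos: "foldr step u s > 0" "foldr step v' t > 0" using Cons.prems by (auto intro: foldr_step_pos)
    have less1: "step L x < 1" and gt1: "step N x > 1" if "x > 0" for x using that by auto
    have eq: "step X (foldr step u s) = step Y (foldr step v' t)" using Cons.prems(5) v by simp
    have "X = L \<or> X = N" "Y = L \<or> Y = N" using Cons.prems(1,2) v by auto
    then have "X = Y" using eq less1 gt1 pos by (metis order_less_asym)
    then have "foldr step u s = foldr step v' t" using eq pos step_inj by blast
    with Cons.IH[of v'] Cons.prems v \<open>X = Y\<close> show ?thesis by auto
  qed auto
qed auto

text \<open>The first letter decides on which side of 1 the value lies. So evaluation at 1 detects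
  nonempty words.\<close>

lemma foldr_step_neq_1:
  assumes "set w \<subseteq> {L, N}" "w \<noteq> []"
  shows "foldr step w 1 \<noteq> 1"
proof (cases w)
  case (Cons X u)
  have "foldr step u 1 > 0" by (rule foldr_step_pos) simp
  then show ?thesis using Cons assms by auto
qed (use assms in auto)

lemma word_eq_one: "set w \<subseteq> {L, N} \<Longrightarrow> word w = \<one>\<^bsub>\<Pi>\<^esub> \<Longrightarrow> w = []"
  using foldr_step_neq_1[of w] act_word[of 1 w] act_word[of 1 "[]"] by auto

text \<open>Freeness of the monoid: equal values at 1 make the words prefix-comparable, and
  cancelling the common prefix leaves a word for the identity, which must be empty.\<close>

lemma word_inj:
  assumes "set u \<subseteq> {L, N}" "set v \<subseteq> {L, N}" "word u = word v"
  shows "u = v"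
proof -
  have *: "x = []" if "word u' = word v'" "v' = u' @ x" "set v' \<subseteq> {L, N}" for u' v' x
  proof -
    have "word u' \<otimes>\<^bsub>\<Pi>\<^esub> word x = word u'" using that by (simp add: word_append)
    then have "word x = \<one>\<^bsub>\<Pi>\<^esub>" by simp
    then show ?thesis using that by (intro word_eq_one) auto
  qed
  have "foldr step u 1 = foldr step v 1" using act_word[of 1 u] act_word[of 1 v] assms(3) by simp
  from foldr_step_prefix[OF assms(1,2) _ _ this]
  consider x where "v = u @ x" | x where "u = v @ x" by auto
  then show ?thesis
  proof cases
    case 1
    from *[OF assms(3) this assms(2)] 1 show ?thesis by simp
  next
    case 2
    from *[OF assms(3)[symmetric] this assms(1)] 2 show ?thesis by simp
  qed
qed

text \<open>By freeness, divisibility from the left becomes the prefix order on words.\<close>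

lemma left_factor_word:
  assumes "set u \<subseteq> {L, N}" "set v \<subseteq> {L, N}"
  shows "left_factor (word u) (word v) \<longleftrightarrow> (\<exists>x. v = u @ x)"
proof
  assume "left_factor (word u) (word v)"
  then obtain x where "set x \<subseteq> {L, N}" "word v = word (u @ x)"
    unfolding left_factor_def by (metis LN_monoid_iff_word word_append)
  with assms have "v = u @ x" by (intro word_inj) auto
  then show "\<exists>x. v = u @ x" by blast
next
  assume "\<exists>x. v = u @ x"
  then obtain x where x: "v = u @ x" by blast
  with assms have "word x \<in> \<M>" by (auto simp: LN_monoid_iff_word)
  with x show "left_factor (word u) (word v)" by (auto simp: left_factor_def word_append)
qed


section \<open>The prefix code of an algorithm\<close>

text \<open>The end points 0 and infinity are left out, which keeps everything within the positive
  reals.\<close>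

definition img :: "label list \<Rightarrow> real set" where
  "img w = foldr step w ` {0<..}"

lemma img_pos: "img w \<subseteq> {0<..}"
  by (auto simp: img_def foldr_step_pos)

lemma img_append: "img (u @ v) \<subseteq> img u"
  by (auto simp: img_def intro!: imageI foldr_step_pos)

text \<open>Inversion permutes the positive reals, so a final F does not change the image; the
  interval of \<open>A a\<close> thus depends on the word of its monoid part alone, apart from the
  labelling of its ends.\<close>

lemma img_snoc_F: "img (w @ [F]) = img w"
proof -
  have "t \<in> step F ` {0<..}" if "t > 0" for t
    using that by (intro image_eqI[of _ _ "1 / t"]) auto
  then have "step F ` {0<..} = {0<..}" by (auto intro: step_pos)
  then show ?thesis by (simp add: img_def image_comp[symmetric] comp_def flip: image_image)
qed

text \<open>This allows a point of the image to be picked away from any finite set of end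
  points.\<close>

lemma infinite_img: "infinite (img w)"
proof -
  have "inj_on (foldr step w) {0<..}" by (rule inj_onI, erule foldr_step_inj) simp_all
  then show ?thesis unfolding img_def using finite_image_iff infinite_Ioi by blast
qed

lemma Delta_eq: "\<Delta> = {0, \<infinity>} \<union> ereal ` {0<..}"
proof -
  have "x \<in> {0, \<infinity>} \<union> ereal ` {0<..}" if "x \<ge> 0" for x :: ereal
    using that by (cases x) auto
  then have "{0..\<infinity>} \<subseteq> {0, \<infinity>} \<union> ereal ` {0<..}" by (meson atLeastAtMost_iff subsetI)
  then show ?thesis unfolding Delta_def by (intro equalityI) auto
qed

lemma act_word_Delta: "act (word w) ` \<Delta> = {act (word w) 0, act (word w) \<infinity>} \<union> ereal ` img w"
proof -
  have "act (word w) ` ereal ` {0<..} = ereal ` img w"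
    unfolding img_def image_image by (rule image_cong) (auto simp: act_word)
  then show ?thesis unfolding Delta_eq image_Un by simp
qed

section \<open>The words attached to a fixed algorithm\<close>

locale slow_cf_algorithm =
  fixes n :: nat and A :: "nat \<Rightarrow> (int^2^2) set"
  assumes slow_cf: "slow_cf n A"
begin

lemma A_closed [simp]: "a < n \<Longrightarrow> A a \<in> carrier \<Pi>"
  and A_nonneg: "a < n \<Longrightarrow> nonneg_entries (A a)"
  and two_le_n: "2 \<le> n"
  and cover_Delta: "(\<Union>a<n. act (A a) ` \<Delta>) = \<Delta>"
  using slow_cf by (simp_all add: slow_cf_def)

lemma A_ordered:
  "a < b \<Longrightarrow> b < n \<Longrightarrow> x \<in> act (A a) ` \<Delta> \<Longrightarrow> y \<in> act (A b) ` \<Delta> \<Longrightarrow> x \<le> y"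
  using slow_cf unfolding slow_cf_def by (meson order_less_trans)

definition code :: "nat \<Rightarrow> label list" where
  "code a = (SOME w. B_part (A a) = word w \<and> set w \<subseteq> {L, N})"

lemma code:
  assumes "a < n"
  shows "B_part (A a) = word (code a)" "set (code a) \<subseteq> {L, N}"
proof -
  have "\<exists>w. B_part (A a) = word w \<and> set w \<subseteq> {L, N}"
    using B_part_in_LN_monoid[OF A_closed A_nonneg] assms by (simp add: LN_monoid_iff_word)
  from someI_ex[OF this] show "B_part (A a) = word (code a)" "set (code a) \<subseteq> {L, N}"
    by (auto simp: code_def)
qed

lemma A_cases:
  assumes "a < n"
  obtains "A a = word (code a)" "e_part (A a) = 0"
  | "A a = word (code a) \<otimes>\<^bsub>\<Pi>\<^esub> gen F" "e_part (A a) = 1"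
  using nonneg_factorization[OF A_closed A_nonneg, OF assms assms]
proof
  assume "A a \<in> \<M>"
  then show ?thesis using that(1) B_part_e_part_LN[of "A a"] code(1)[OF assms] by simp
next
  assume "A a \<otimes>\<^bsub>\<Pi>\<^esub> gen F \<in> \<M>"
  from B_part_e_part_LN_F[OF _ this] assms have
    "word (code a) = A a \<otimes>\<^bsub>\<Pi>\<^esub> gen F" "e_part (A a) = 1" using code(1)[OF assms] by simp_all
  then show ?thesis using that(2) assms by simp
qed

lemma act_A_Delta:
  assumes "a < n"
  shows "act (A a) ` \<Delta> = {act (A a) 0, act (A a) \<infinity>} \<union> ereal ` img (code a)"
  using assms
proof (cases rule: A_cases)
  case 1
  show ?thesis unfolding 1(1) by (rule act_word_Delta)
next
  case 2
  then have "A a = word (code a @ [F])" by (simp add: word_append)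
  then show ?thesis using act_word_Delta[of "code a @ [F]"] by (simp add: img_snoc_F)
qed

text \<open>Otherwise two intervals of the partition would share two distinct points, which their order
  forbids.\<close>

lemma code_prefix_free:
  assumes "a < n" "b < n" "code b = code a @ x"
  shows "a = b"
proof (rule ccontr)
  assume "a \<noteq> b"
  \<comment> \<open>The arguments 1 and 2 are just two different positive numbers; injectivity of
    \<open>foldr step\<close> keeps their images apart.\<close>
  define p q where "p = foldr step (code b) 1" and "q = foldr step (code b) 2"
  have "p \<in> img (code b)" "q \<in> img (code b)" by (auto simp: img_def p_def q_def)
  then have in_A: "ereal p \<in> act (A a) ` \<Delta>" "ereal q \<in> act (A a) ` \<Delta>"
      "ereal p \<in> act (A b) ` \<Delta>" "ereal q \<in> act (A b) ` \<Delta>"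
    using img_append[of "code a" x] assms by (auto simp: act_A_Delta)
  have "a < b \<or> b < a" using \<open>a \<noteq> b\<close> by linarith
  then have "ereal p \<le> ereal q \<and> ereal q \<le> ereal p"
    using A_ordered[OF _ assms(2)] A_ordered[OF _ assms(1)] in_A by meson
  then have "p = q" by simp
  then show False using foldr_step_inj[of "code b" 1 2] by (simp add: p_def q_def)
qed

text \<open>Infinitely many points lie in the image of a word, but only finitely many are end points
  of the intervals of the partition.\<close>

lemma code_comparable:
  assumes "set w \<subseteq> {L, N}"
  shows "\<exists>a<n. (\<exists>x. w = code a @ x) \<or> (\<exists>x. code a = w @ x)"
proof -
  define E where "E = (\<Union>a<n. {act (A a) 0, act (A a) \<infinity>})"
  have "infinite (ereal ` img w)" by (simp add: finite_image_iff infinite_img)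
  moreover have "finite E" by (simp add: E_def)
  ultimately have "infinite (ereal ` img w - E)" by (rule Diff_infinite_finite[rotated])
  then have "ereal ` img w - E \<noteq> {}" using finite.emptyI by metis
  then obtain p where p: "p \<in> img w" "ereal p \<notin> E" by blast
  have "ereal p \<in> \<Delta>" using p img_pos[of w] by (auto simp: Delta_eq)
  then obtain a where a: "a < n" "ereal p \<in> act (A a) ` \<Delta>" using cover_Delta by blast
  then have "p \<in> img (code a)" using p(2) by (auto simp: act_A_Delta E_def)
  with p(1) obtain s t where "s > 0" "t > 0" "foldr step w s = foldr step (code a) t"
    by (auto simp: img_def)
  from foldr_step_prefix[OF assms code(2)[OF a(1)] this] a(1) show ?thesis by blast
qed

text \<open>The empty word is a prefix of every code word, which prefix-freeness excludes once there
  are two intervals.\<close>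

lemma code_nonempty: "a < n \<Longrightarrow> code a \<noteq> []"
proof
  assume a: "a < n" "code a = []"
  obtain b where "b < n" "b \<noteq> a" using two_le_n 
    by (metis One_nat_def Suc_1 Suc_le_lessD less_trans zero_less_one zero_neq_one)
  with code_prefix_free[of a b "code b"] a show False by simp
qed

definition prefixes :: "label list set" where
  "prefixes = {w. \<exists>a<n. \<exists>x. code a = w @ x}"

lemma prefixes_LN: "w \<in> prefixes \<Longrightarrow> set w \<subseteq> {L, N}"
  unfolding prefixes_def using code(2) by fastforce

lemma finite_prefixes: "finite prefixes"
proof -
  have "prefixes \<subseteq> (\<Union>a<n. (\<lambda>k. take k (code a)) ` {..length (code a)})"
  proof
    fix w assume "w \<in> prefixes"
    then obtain a x where a: "a < n" "code a = w @ x" by (auto simp: prefixes_def)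
    then have "w = take (length w) (code a)" "length w \<le> length (code a)" by simp_all
    then show "w \<in> (\<Union>a<n. (\<lambda>k. take k (code a)) ` {..length (code a)})" using a(1) by blast
  qed
  then show ?thesis by (rule finite_subset) simp
qed

lemma code_in_prefixes: "a < n \<Longrightarrow> code a \<in> prefixes"
  by (auto simp: prefixes_def)

lemma Nil_in_prefixes: "[] \<in> prefixes"
  using two_le_n by (auto simp: prefixes_def intro!: exI[of _ 0])

text \<open>Completeness of the code: the extended word is comparable with some code word. If that
  code word were already a prefix of \<open>w\<close>, prefix-freeness would make \<open>w\<close> a
  code word itself.\<close>

lemma prefixes_snoc:
  assumes "w \<in> prefixes" "w \<notin> code ` {..<n}" "X \<in> {L, N}"
  shows "w @ [X] \<in> prefixes"
proof -
  obtain a x where a: "a < n" "code a = w @ x" using assms(1) by (auto simp: prefixes_def)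
  have "set (w @ [X]) \<subseteq> {L, N}" using prefixes_LN[OF assms(1)] assms(3) by auto
  then obtain b where b: "b < n" and "(\<exists>y. w @ [X] = code b @ y) \<or> (\<exists>y. code b = (w @ [X]) @ y)"
    using code_comparable by blast
  then consider y where "w @ [X] = code b @ y" | y where "code b = (w @ [X]) @ y" by blast
  then show ?thesis
  proof cases
    case 1
    show ?thesis
    proof (cases y rule: rev_cases)
      case Nil
      then show ?thesis using 1 b code_in_prefixes by simp
    next
      case (snoc y' Y)
      \<comment> \<open>Now \<open>code b\<close> is a prefix of \<open>w\<close>, hence of
        \<open>code a\<close>; the two indices agree, and nothing remains for
        \<open>y'\<close>.\<close>
      then have w: "w = code b @ y'" using 1 by simp
      then have "code a = code b @ (y' @ x)" using a by simp
      from code_prefix_free[OF b a(1) this] this have "y' = []" by simp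
      then show ?thesis using w b assms(2) by simp
    qed
  next
    case 2
    then show ?thesis using b by (auto simp: prefixes_def)
  qed
qed

lemma code_snoc_notin_prefixes: "a < n \<Longrightarrow> code a @ [X] \<notin> prefixes"
proof
  assume a: "a < n" "code a @ [X] \<in> prefixes"
  then obtain b x where b: "b < n" "code b = code a @ ([X] @ x)" by (auto simp: prefixes_def)
  from code_prefix_free[OF a(1) this] b(2) show False by simp
qed

section \<open>The retraction that glues the leaves\<close>

lemma kept_verts_eq:
  "kept_verts n A = word ` prefixes \<union> (\<lambda>w. word w \<otimes>\<^bsub>\<Pi>\<^esub> gen F) ` prefixes"
proof -
  have "{B \<in> \<M>. \<exists>a<n. left_factor B (B_part (A a))} = word ` prefixes"
  proof (intro equalityI subsetI)
    fix B assume "B \<in> {B \<in> \<M>. \<exists>a<n. left_factor B (B_part (A a))}"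
    then obtain w a where w: "B = word w" "set w \<subseteq> {L, N}" "a < n" "left_factor B (B_part (A a))"
      by (auto simp: LN_monoid_iff_word)
    then have "w \<in> prefixes"
      using left_factor_word[OF w(2) code(2)[OF w(3)]] by (auto simp: prefixes_def code(1))
    then show "B \<in> word ` prefixes" using w(1) by blast
  next
    fix B assume "B \<in> word ` prefixes"
    then obtain w where w: "B = word w" "w \<in> prefixes" by blast
    then obtain a x where a: "a < n" "code a = w @ x" by (auto simp: prefixes_def)
    then have "left_factor B (B_part (A a))"
      using left_factor_word[OF prefixes_LN[OF w(2)] code(2)[OF a(1)]] w(1) by (auto simp: code(1))
    then show "B \<in> {B \<in> \<M>. \<exists>a<n. left_factor B (B_part (A a))}"
      using a(1) w prefixes_LN by (auto simp: LN_monoid_iff_word)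
  qed
  then show ?thesis by (auto simp: kept_verts_def)
qed

lemma kept_closed: "v \<in> kept_verts n A \<Longrightarrow> v \<in> carrier \<Pi>"
  by (auto simp: kept_verts_eq)

lemma finite_kept_verts: "finite (kept_verts n A)"
  by (simp add: kept_verts_eq finite_prefixes)

lemma word_neq_word_F:
  "set u \<subseteq> {L, N} \<Longrightarrow> set v \<subseteq> {L, N} \<Longrightarrow> word u \<noteq> word v \<otimes>\<^bsub>\<Pi>\<^esub> gen F"
  using LN_monoid_mult_F[of "word v"] by (metis LN_monoid_iff_word)

lemma word_F_inj:
  "set u \<subseteq> {L, N} \<Longrightarrow> set v \<subseteq> {L, N} \<Longrightarrow> word u \<otimes>\<^bsub>\<Pi>\<^esub> gen F = word v \<otimes>\<^bsub>\<Pi>\<^esub> gen F \<Longrightarrow> u = v"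
  by (rule word_inj) simp_all

lemma word_in_kept:
  assumes "set w \<subseteq> {L, N}"
  shows "word w \<in> kept_verts n A \<longleftrightarrow> w \<in> prefixes"
    and "word w \<otimes>\<^bsub>\<Pi>\<^esub> gen F \<in> kept_verts n A \<longleftrightarrow> w \<in> prefixes"
  unfolding kept_verts_eq image_iff Un_iff bex_simps
  by (metis assms prefixes_LN word_inj word_neq_word_F word_F_inj)+

text \<open>Stated with \<open>A a\<close> instead of its monoid part: the pair of leaves is the
  same up to order, and the gluing rule then takes one form for both values of
  \<open>e_part\<close>.\<close>

definition leaf :: "(int^2^2) set \<Rightarrow> bool" where
  "leaf v \<longleftrightarrow> (\<exists>a<n. v = A a \<or> v = A a \<otimes>\<^bsub>\<Pi>\<^esub> gen F)"

lemma leaf_iff_code: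
  "leaf v \<longleftrightarrow> (\<exists>a<n. v = word (code a) \<or> v = word (code a) \<otimes>\<^bsub>\<Pi>\<^esub> gen F)"
proof -
  have "(v = A a \<or> v = A a \<otimes>\<^bsub>\<Pi>\<^esub> gen F) \<longleftrightarrow> (v = word (code a) \<or> v = word (code a) \<otimes>\<^bsub>\<Pi>\<^esub> gen F)"
    if "a < n" for a
    using that by (cases rule: A_cases) auto
  then show ?thesis by (auto simp: leaf_def)
qed

lemma one_kept: "\<one>\<^bsub>\<Pi>\<^esub> \<in> kept_verts n A"
  using Nil_in_prefixes word_in_kept(1)[of "[]"] by simp

lemma F_kept: "gen F \<in> kept_verts n A"
  using Nil_in_prefixes word_in_kept(2)[of "[]"] by simp

text \<open>Since no code word is empty, the targets of the gluing are inner vertices, and a single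
  retraction step suffices. The same argument applies to \<open>gen F\<close>.\<close>

lemma not_leaf_one: "\<not> leaf \<one>\<^bsub>\<Pi>\<^esub>"
proof
  assume "leaf \<one>\<^bsub>\<Pi>\<^esub>"
  then obtain a where a: "a < n"
    "word [] = word (code a) \<or> word [] = word (code a) \<otimes>\<^bsub>\<Pi>\<^esub> gen F"
    by (auto simp: leaf_iff_code)
  have "set [] \<subseteq> {L, N}" by simp
  from a(2) word_inj[OF this code(2)[OF a(1)]] word_neq_word_F[OF this code(2)[OF a(1)]]
    code_nonempty[OF a(1)] show False by argo
qed

lemma not_leaf_F: "\<not> leaf (gen F)"
proof
  assume "leaf (gen F)"
  then obtain a where a: "a < n"
    "word (code a) = word [] \<otimes>\<^bsub>\<Pi>\<^esub> gen F \<or> word [] \<otimes>\<^bsub>\<Pi>\<^esub> gen F = word (code a) \<otimes>\<^bsub>\<Pi>\<^esub> gen F"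
    by (auto simp: leaf_iff_code)
  have "set [] \<subseteq> {L, N}" by simp
  from a(2) word_F_inj[OF this code(2)[OF a(1)]] word_neq_word_F[OF code(2)[OF a(1)] this]
    code_nonempty[OF a(1)] show False by argo
qed

lemma kept_mult_F: "v \<in> kept_verts n A \<Longrightarrow> v \<otimes>\<^bsub>\<Pi>\<^esub> gen F \<in> kept_verts n A"
  by (auto simp: kept_verts_eq)

text \<open>Moving F to the right past a letter exchanges L and N.\<close>

lemma word_F_mult:
  "word w \<otimes>\<^bsub>\<Pi>\<^esub> gen F \<otimes>\<^bsub>\<Pi>\<^esub> gen L = word (w @ [N]) \<otimes>\<^bsub>\<Pi>\<^esub> gen F"
  "word w \<otimes>\<^bsub>\<Pi>\<^esub> gen F \<otimes>\<^bsub>\<Pi>\<^esub> gen N = word (w @ [L]) \<otimes>\<^bsub>\<Pi>\<^esub> gen F"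
  by (simp_all add: word_append PGL2Z.m_assoc gen_relations)

lemma kept_mult_iff:
  assumes "set w \<subseteq> {L, N}" "X \<in> {L, N}"
  shows "word w \<otimes>\<^bsub>\<Pi>\<^esub> gen X \<in> kept_verts n A \<longleftrightarrow> w @ [X] \<in> prefixes"
    and "word w \<otimes>\<^bsub>\<Pi>\<^esub> gen F \<otimes>\<^bsub>\<Pi>\<^esub> gen X \<in> kept_verts n A \<longleftrightarrow> w @ [if X = L then N else L] \<in> prefixes"
proof -
  have "word w \<otimes>\<^bsub>\<Pi>\<^esub> gen X = word (w @ [X])" by (simp add: word_append)
  then show "word w \<otimes>\<^bsub>\<Pi>\<^esub> gen X \<in> kept_verts n A \<longleftrightarrow> w @ [X] \<in> prefixes"
    using assms by (simp add: word_in_kept(1) del: word_append)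
  have "word w \<otimes>\<^bsub>\<Pi>\<^esub> gen F \<otimes>\<^bsub>\<Pi>\<^esub> gen X = word (w @ [if X = L then N else L]) \<otimes>\<^bsub>\<Pi>\<^esub> gen F"
    using assms(2) by (auto simp: word_F_mult)
  then show "word w \<otimes>\<^bsub>\<Pi>\<^esub> gen F \<otimes>\<^bsub>\<Pi>\<^esub> gen X \<in> kept_verts n A \<longleftrightarrow> w @ [if X = L then N else L] \<in> prefixes"
    using assms by (simp add: word_in_kept(2))
qed

text \<open>Inner vertices keep both children because the code is complete; in the twin tree the two
  letters merely trade places.\<close>

lemma kept_mult:
  assumes "v \<in> kept_verts n A" "\<not> leaf v"
  shows "v \<otimes>\<^bsub>\<Pi>\<^esub> gen X \<in> kept_verts n A"
proof (cases "X = F")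
  case True
  then show ?thesis using assms kept_mult_F by simp
next
  case False
  then have X: "X \<in> {L, N}" "(if X = L then N else L) \<in> {L, N}" by (cases X; simp)+
  obtain w where w: "w \<in> prefixes" "v = word w \<or> v = word w \<otimes>\<^bsub>\<Pi>\<^esub> gen F"
    using assms(1) by (auto simp: kept_verts_eq)
  with assms(2) have "w \<notin> code ` {..<n}" by (auto simp: leaf_iff_code)
  then show ?thesis
    using w X prefixes_snoc[OF w(1)] kept_mult_iff[OF prefixes_LN[OF w(1)] X(1)] by auto
qed

text \<open>Prefix-freeness cuts off both children of a leaf, so before gluing its F-edge is the
  only one that leaves it within the kept vertices.\<close>

lemma leaf_mult:
  assumes "leaf v" "v \<otimes>\<^bsub>\<Pi>\<^esub> gen X \<in> kept_verts n A"
  shows "X = F"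
proof (rule ccontr)
  assume "X \<noteq> F"
  then have X: "X \<in> {L, N}" by (cases X) auto
  obtain a where a: "a < n" "v = word (code a) \<or> v = word (code a) \<otimes>\<^bsub>\<Pi>\<^esub> gen F"
    using assms(1) by (auto simp: leaf_iff_code)
  then show False
    using assms(2) kept_mult_iff[OF code(2)[OF a(1)] X] code_snoc_notin_prefixes[OF a(1)] by auto
qed

text \<open>No leaf is sent both to 1 and to F. Equal exponents would identify a word with a word
  times F; different exponents would force equal words, hence equal indices and equal
  exponents.\<close>

lemma A_mult_F_neq: "a < n \<Longrightarrow> b < n \<Longrightarrow> A a \<otimes>\<^bsub>\<Pi>\<^esub> gen F \<noteq> A b"
proof
  assume ab: "a < n" "b < n" and eq: "A a \<otimes>\<^bsub>\<Pi>\<^esub> gen F = A b"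
  note LN = code(2)[OF ab(1)] code(2)[OF ab(2)]
  have inj: "a = b" if "code a = code b"
    using code_prefix_free[OF ab, of "[]"] that by simp
  show False
  proof (cases rule: A_cases[OF ab(1)])
    case a: 1
    show ?thesis
    proof (cases rule: A_cases[OF ab(2)])
      case 1
      then show ?thesis using a eq word_neq_word_F[OF LN(2,1)] by simp
    next
      case 2
      then have "a = b" using a(1) eq inj word_F_inj[OF LN] by simp
      then show ?thesis using a(2) 2(2) by simp
    qed
  next
    case a: 2
    show ?thesis
    proof (cases rule: A_cases[OF ab(2)])
      case 1
      then have "a = b" using a(1) eq inj word_inj[OF LN] by simp
      then show ?thesis using a(2) 1(2) by simp
    next
      case 2
      then show ?thesis using a(1) eq word_neq_word_F[OF LN] by simp
    qed
  qed
qed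

text \<open>A normal form for the gluing: equality of classes becomes equality of retracted
  vertices. The first two branches exclude each other by \<open>A_mult_F_neq\<close>.\<close>

definition retract :: "(int^2^2) set \<Rightarrow> (int^2^2) set" where
  "retract v = (if v \<in> A ` {..<n} then \<one>\<^bsub>\<Pi>\<^esub>
     else if v \<in> (\<lambda>a. A a \<otimes>\<^bsub>\<Pi>\<^esub> gen F) ` {..<n} then gen F else v)"

lemma retract_A [simp]: "a < n \<Longrightarrow> retract (A a) = \<one>\<^bsub>\<Pi>\<^esub>"
  by (simp add: retract_def)

lemma retract_A_F [simp]: "a < n \<Longrightarrow> retract (A a \<otimes>\<^bsub>\<Pi>\<^esub> gen F) = gen F"
  using A_mult_F_neq by (auto simp: retract_def)

lemma retract_not_leaf: "\<not> leaf v \<Longrightarrow> retract v = v"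
  by (auto simp: retract_def leaf_def)

lemma retract_one [simp]: "retract \<one>\<^bsub>\<Pi>\<^esub> = \<one>\<^bsub>\<Pi>\<^esub>"
  and retract_F [simp]: "retract (gen F) = gen F"
  by (simp_all add: retract_not_leaf not_leaf_one not_leaf_F)

lemma not_leaf_retract: "\<not> leaf (retract v)"
  using not_leaf_one not_leaf_F by (auto simp: retract_def leaf_def)

lemma retract_kept: "v \<in> kept_verts n A \<Longrightarrow> retract v \<in> kept_verts n A"
  using one_kept F_kept by (simp add: retract_def)

text \<open>Edges descend to the quotient. At a leaf only the F-edge is kept, and it joins
  \<open>A a\<close> and its twin just as the F-edge at the root joins 1 and F.\<close>

lemma retract_mult:
  assumes "u \<in> kept_verts n A" "u \<otimes>\<^bsub>\<Pi>\<^esub> gen X \<in> kept_verts n A"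
  shows "retract (u \<otimes>\<^bsub>\<Pi>\<^esub> gen X) = retract (retract u \<otimes>\<^bsub>\<Pi>\<^esub> gen X)"
proof (cases "leaf u")
  case True
  then have X: "X = F" using leaf_mult assms(2) by blast
  from True obtain a where "a < n" "u = A a \<or> u = A a \<otimes>\<^bsub>\<Pi>\<^esub> gen F" by (auto simp: leaf_def)
  then show ?thesis using X by auto
next
  case False
  then show ?thesis by (simp add: retract_not_leaf)
qed

text \<open>For exponent 1 the element \<open>A a\<close> is the twin leaf, so the exchanged gluing
  still sends \<open>A a\<close> to 1.\<close>

lemma glue_eq: "glue n A = (\<Union>a<n. {(A a, \<one>\<^bsub>\<Pi>\<^esub>), (A a \<otimes>\<^bsub>\<Pi>\<^esub> gen F, gen F)})"
proof -
  have "(if e_part (A a) = 0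
       then {(B_part (A a), \<one>\<^bsub>\<Pi>\<^esub>), (B_part (A a) \<otimes>\<^bsub>\<Pi>\<^esub> gen F, gen F)}
       else {(B_part (A a), gen F), (B_part (A a) \<otimes>\<^bsub>\<Pi>\<^esub> gen F, \<one>\<^bsub>\<Pi>\<^esub>)})
    = {(A a, \<one>\<^bsub>\<Pi>\<^esub>), (A a \<otimes>\<^bsub>\<Pi>\<^esub> gen F, gen F)}" if "a < n" for a
    using that
  proof (cases rule: A_cases)
    case 1
    then have "B_part (A a) = A a" using code(1)[OF that] by simp
    then show ?thesis using 1(2) by simp
  next
    case 2
    then have "B_part (A a) = A a \<otimes>\<^bsub>\<Pi>\<^esub> gen F" using code(1)[OF that] by simp
    then show ?thesis using 2(2) that by (simp add: insert_commute)
  qed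
  then show ?thesis unfolding glue_def by simp
qed

lemma retract_glue_equiv:
  assumes "(u, v) \<in> glue_equiv n A"
  shows "retract u = retract v"
  using assms unfolding glue_equiv_def
proof (induction rule: rtrancl_induct)
  case (step v w)
  have *: "retract x = retract y" if xy: "(x, y) \<in> glue n A" for x y
  proof -
    obtain a where "a < n" "x = A a \<and> y = \<one>\<^bsub>\<Pi>\<^esub> \<or> x = A a \<otimes>\<^bsub>\<Pi>\<^esub> gen F \<and> y = gen F"
      using xy unfolding glue_eq by blast
    then show ?thesis using retract_A retract_A_F retract_one retract_F by metis
  qed
  have "retract v = retract w" using step.hyps(2) *[of v w] *[of w v] by fastforce
  with step.IH show ?case by simp
qed simp

lemma glue_equiv_retract: "(v, retract v) \<in> glue_equiv n A"
proof -
  have "(v, retract v) \<in> glue n A \<or> v = retract v"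
    by (auto simp: retract_def glue_eq)
  then show ?thesis by (auto simp: glue_equiv_def)
qed

lemma equiv_glue_equiv: "equiv UNIV (glue_equiv n A)"
  unfolding glue_equiv_def
  by (intro equivI sym_rtrancl trans_rtrancl refl_rtrancl) (auto simp: sym_def)

lemma glue_equiv_iff: "(u, v) \<in> glue_equiv n A \<longleftrightarrow> retract u = retract v"
proof
  assume "retract u = retract v"
  then have "(u, retract v) \<in> glue_equiv n A" using glue_equiv_retract[of u] by simp
  moreover have "(retract v, v) \<in> glue_equiv n A"
    using glue_equiv_retract[of v] equiv_glue_equiv by (meson equivE symE)
  ultimately show "(u, v) \<in> glue_equiv n A"
    using equiv_glue_equiv by (meson equivE transE)
qed (rule retract_glue_equiv)

end


section \<open>Generators of PGL(2,Z)\<close>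

text \<open>The equivalence in the step covers multiplication by generators and by their inverses,
  so this says that L, N and F generate \<Pi>. The Euclidean algorithm on the first row reduces
  every matrix to a lower triangular one.\<close>

lemma PGL2Z_gen_induct:
  assumes P: "P \<in> carrier \<Pi>" and one: "Q \<one>\<^bsub>\<Pi>\<^esub>"
    and gen: "\<And>P X. P \<in> carrier \<Pi> \<Longrightarrow> Q (P \<otimes>\<^bsub>\<Pi>\<^esub> gen X) \<longleftrightarrow> Q P"
  shows "Q P"
proof -
  define q where "q a b c d = Q (proj (mat2 a b c d))" for a b c d
  have qL: "q (a + b) b (c + d) d \<longleftrightarrow> q a b c d" if "\<bar>a*d - b*c\<bar> = 1" for a b c d
    using gen[of "proj (mat2 a b c d)" L] that by (simp add: q_def proj_mult_gen proj_mat2_closed)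
  have qN: "q a (a + b) c (c + d) \<longleftrightarrow> q a b c d" if "\<bar>a*d - b*c\<bar> = 1" for a b c d
    using gen[of "proj (mat2 a b c d)" N] that by (simp add: q_def proj_mult_gen proj_mat2_closed)
  have qF: "q b a d c \<longleftrightarrow> q a b c d" if "\<bar>a*d - b*c\<bar> = 1" for a b c d
    using gen[of "proj (mat2 a b c d)" F] that by (simp add: q_def proj_mult_gen proj_mat2_closed)
  have qL': "q (a - b) b (c - d) d \<longleftrightarrow> q a b c d" if "\<bar>a*d - b*c\<bar> = 1" for a b c d
    using qL[of "a - b" d b "c - d"] that by (simp add: algebra_simps)
  have qN': "q a (b - a) c (d - c) \<longleftrightarrow> q a b c d" if "\<bar>a*d - b*c\<bar> = 1" for a b c d
    using qN[of a "d - c" "b - a" c] that by (simp add: algebra_simps)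
  have neg: "q (- a) (- b) (- c) (- d) \<longleftrightarrow> q a b c d" for a b c d
    by (simp add: q_def proj_eq insert_commute)
  have q1: "q 1 0 0 1" using one by (simp add: q_def one_PGL2Z)
  \<comment> \<open>Multiplying minus the identity, a representative of the identity, by L, the
    inverse of N, L and F in turn yields the diagonal matrix with entries 1 and -1.\<close>
  have "q (- 1) 0 0 (- 1)" using q1 neg[of 1 0 0 1] by simp
  then have "q (- 1) 0 (- 1) (- 1)" using qL[of "-1" "-1" 0 0] by simp
  then have "q (- 1) 1 (- 1) 0" using qN'[of "-1" "-1" 0 "-1"] by simp
  then have "q 0 1 (- 1) 0" using qL[of "-1" 0 1 "-1"] by simp
  then have qm: "q 1 0 0 (- 1)" using qF[of 1 "-1" 0 0] by simp
  have lower1: "q 1 0 c 1" for c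
    by (induction c rule: int_induct[of _ 0]) (use q1 qL[of 1 1 0] qL'[of 1 1 0] in auto)
  have lowerm: "q 1 0 c (- 1)" for c
    by (induction c rule: int_induct[of _ 0]) (use qm qL[of 1 "-1" 0] qL'[of 1 "-1" 0] in auto)
  have lower: "q a 0 c d" if "\<bar>a*d\<bar> = 1" for a c d
  proof -
    have "\<bar>a\<bar> = 1" "\<bar>d\<bar> = 1" using that by (auto simp: abs_mult zmult_eq_1_iff)
    then have "a = 1 \<or> a = -1" and d: "d = 1 \<or> d = -1" by linarith+
    have "q 1 0 c d" using d lower1 lowerm by blast
    \<comment> \<open>The case \<open>a = -1\<close> passes to the negative matrix, whose upper left
      entry is 1.\<close>
    moreover have "q 1 0 (- c) (- d)" using d lower1 lowerm by force
    then have "q (- 1) 0 c d" using neg[of 1 0 "- c" "- d"] by simp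
    ultimately show ?thesis using \<open>a = 1 \<or> a = -1\<close> by blast
  qed
  have "q a b c d" if "\<bar>a*d - b*c\<bar> = 1" for a b c d
    using that
  proof (induction "nat (\<bar>a\<bar> + \<bar>b\<bar>)" arbitrary: a b c d rule: less_induct)
    case less
    have dets: "\<bar>(a - b) * d - b * (c - d)\<bar> = 1" "\<bar>(a + b) * d - b * (c + d)\<bar> = 1"
      "\<bar>a * (d - c) - (b - a) * c\<bar> = 1" "\<bar>a * (d + c) - (b + a) * c\<bar> = 1"
      using less.prems by (simp_all add: algebra_simps)
    consider "b = 0" | "a = 0" | "a \<noteq> 0" "b \<noteq> 0" by blast
    then show ?case
    proof cases
      case 1
      then show ?thesis using lower less.prems by simp
    next
      case 2
      then have "q b 0 d c" using less.prems by (intro lower) simp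
      then show ?thesis using 2 qF[OF less.prems] by simp
    next
      case 3
      \<comment> \<open>With equal signs the entry of smaller absolute value is subtracted from the
        other; with opposite signs it is added.\<close>
      then consider "\<bar>a - b\<bar> < \<bar>a\<bar>" | "\<bar>a + b\<bar> < \<bar>a\<bar>" | "\<bar>b - a\<bar> < \<bar>b\<bar>" | "\<bar>b + a\<bar> < \<bar>b\<bar>"
        by linarith
      then show ?thesis
      proof cases
        case 1
        then have "q (a - b) b (c - d) d" by (intro less.hyps dets) simp
        then show ?thesis using qL'[OF less.prems] by simp
      next
        case 2
        then have "q (a + b) b (c + d) d" by (intro less.hyps dets) simp
        then show ?thesis using qL[OF less.prems] by simp
      next
        case 3
        then have "q a (b - a) c (d - c)" by (intro less.hyps dets) simp
        then show ?thesis using qN'[OF less.prems] by simp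
      next
        case 4
        then have "q a (b + a) c (d + c)" by (intro less.hyps dets) simp
        then show ?thesis using qN[OF less.prems] by (simp add: add.commute)
      qed
    qed
  qed
  moreover obtain a b c d where "P = proj (mat2 a b c d)" "\<bar>a*d - b*c\<bar> = 1"
    using P by (rule PGL2Z_cases)
  ultimately show ?thesis by (simp add: q_def)
qed

section \<open>The opfibration\<close>

context slow_cf_algorithm
begin

section \<open>Right cosets of the generated subgroup\<close>

abbreviation S where "S \<equiv> Sigma_T n A"

lemma subgroup_S: "subgroup S \<Pi>"
  unfolding Sigma_T_def by (rule PGL2Z.generate_is_subgroup) auto

lemma S_subset: "S \<subseteq> carrier \<Pi>"
  by (rule subgroup.subset[OF subgroup_S])

lemma coset_mult: "P \<in> carrier \<Pi> \<Longrightarrow> Q \<in> carrier \<Pi> \<Longrightarrow>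
    S #>\<^bsub>\<Pi>\<^esub> (P \<otimes>\<^bsub>\<Pi>\<^esub> Q) = (S #>\<^bsub>\<Pi>\<^esub> P) #>\<^bsub>\<Pi>\<^esub> Q"
  by (simp add: PGL2Z.coset_mult_assoc S_subset)

lemma coset_A: "a < n \<Longrightarrow> S #>\<^bsub>\<Pi>\<^esub> A a = S"
  by (intro PGL2Z.coset_join2 subgroup_S) (auto simp: Sigma_T_def intro: generate.incl)

lemma coset_one: "S #>\<^bsub>\<Pi>\<^esub> \<one>\<^bsub>\<Pi>\<^esub> = S"
  by (rule PGL2Z.coset_mult_one[OF S_subset])

text \<open>Since \<open>A a\<close> lies in \<open>S\<close>, replacing \<open>A a\<close> by 1, or
  its product with F by F, stays within the coset. This is why cosets are compatible with the
  gluing.\<close>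

lemma coset_retract: "S #>\<^bsub>\<Pi>\<^esub> retract v = S #>\<^bsub>\<Pi>\<^esub> v"
proof (cases "leaf v")
  case True
  then obtain a where "a < n" "v = A a \<or> v = A a \<otimes>\<^bsub>\<Pi>\<^esub> gen F" by (auto simp: leaf_def)
  then show ?thesis
  proof (elim disjE)
    assume "a < n" "v = A a"
    then show ?thesis by (simp add: coset_A coset_one)
  next
    assume "a < n" "v = A a \<otimes>\<^bsub>\<Pi>\<^esub> gen F"
    then show ?thesis by (simp add: coset_A coset_mult)
  qed
qed (simp add: retract_not_leaf)

lemma coset_mult_cancel:
  assumes "P \<in> carrier \<Pi>" "Q \<in> carrier \<Pi>" "R \<in> carrier \<Pi>"
    "S #>\<^bsub>\<Pi>\<^esub> (P \<otimes>\<^bsub>\<Pi>\<^esub> R) = S #>\<^bsub>\<Pi>\<^esub> (Q \<otimes>\<^bsub>\<Pi>\<^esub> R)"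
  shows "S #>\<^bsub>\<Pi>\<^esub> P = S #>\<^bsub>\<Pi>\<^esub> Q"
proof -
  have "S #>\<^bsub>\<Pi>\<^esub> (P \<otimes>\<^bsub>\<Pi>\<^esub> R \<otimes>\<^bsub>\<Pi>\<^esub> inv\<^bsub>\<Pi>\<^esub> R) = S #>\<^bsub>\<Pi>\<^esub> (Q \<otimes>\<^bsub>\<Pi>\<^esub> R \<otimes>\<^bsub>\<Pi>\<^esub> inv\<^bsub>\<Pi>\<^esub> R)"
    using assms by (simp add: coset_mult)
  then show ?thesis using assms by (simp add: PGL2Z.m_assoc)
qed

text \<open>The cosets met by the kept vertices form a finite set on which every generator acts
  injectively, hence surjectively; this makes up for the generators having no inverses in the
  monoid they generate.\<close>

lemma coset_kept:
  assumes "P \<in> carrier \<Pi>"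
  shows "S #>\<^bsub>\<Pi>\<^esub> P \<in> (\<lambda>v. S #>\<^bsub>\<Pi>\<^esub> v) ` kept_verts n A"
proof (rule PGL2Z_gen_induct[OF assms])
  show "S #>\<^bsub>\<Pi>\<^esub> \<one>\<^bsub>\<Pi>\<^esub> \<in> (\<lambda>v. S #>\<^bsub>\<Pi>\<^esub> v) ` kept_verts n A" using one_kept by blast
next
  fix P X
  assume P: "P \<in> carrier \<Pi>"
  let ?I = "(\<lambda>v. S #>\<^bsub>\<Pi>\<^esub> v) ` kept_verts n A"
  define f where "f C = C #>\<^bsub>\<Pi>\<^esub> gen X" for C
  have f: "f (S #>\<^bsub>\<Pi>\<^esub> v) = S #>\<^bsub>\<Pi>\<^esub> (v \<otimes>\<^bsub>\<Pi>\<^esub> gen X)" if "v \<in> carrier \<Pi>" for v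
    using that by (simp add: f_def coset_mult)
  have "f ` ?I \<subseteq> ?I"
  proof clarify
    fix v assume v: "v \<in> kept_verts n A"
    \<comment> \<open>Retracting first replaces a leaf by an inner vertex of the same coset, whose
      neighbours are all kept.\<close>
    have r: "retract v \<otimes>\<^bsub>\<Pi>\<^esub> gen X \<in> kept_verts n A"
      using v by (intro kept_mult retract_kept not_leaf_retract)
    have "f (S #>\<^bsub>\<Pi>\<^esub> v) = S #>\<^bsub>\<Pi>\<^esub> (retract v \<otimes>\<^bsub>\<Pi>\<^esub> gen X)"
      using f[of "retract v"] v by (simp add: coset_retract kept_closed retract_kept)
    then show "f (S #>\<^bsub>\<Pi>\<^esub> v) \<in> ?I" using r by blast
  qed
  moreover have "inj_on f ?I"
  proof (intro inj_onI, clarify)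
    fix u v assume "u \<in> kept_verts n A" "v \<in> kept_verts n A" "f (S #>\<^bsub>\<Pi>\<^esub> u) = f (S #>\<^bsub>\<Pi>\<^esub> v)"
    then show "S #>\<^bsub>\<Pi>\<^esub> u = S #>\<^bsub>\<Pi>\<^esub> v"
      using coset_mult_cancel[of u v "gen X"] by (simp add: f kept_closed)
  qed
  ultimately have f_img: "f ` ?I = ?I"
    using finite_kept_verts by (intro endo_inj_surj) auto
  show "S #>\<^bsub>\<Pi>\<^esub> (P \<otimes>\<^bsub>\<Pi>\<^esub> gen X) \<in> ?I \<longleftrightarrow> S #>\<^bsub>\<Pi>\<^esub> P \<in> ?I"
  proof
    assume "S #>\<^bsub>\<Pi>\<^esub> P \<in> ?I"
    then have "f (S #>\<^bsub>\<Pi>\<^esub> P) \<in> ?I" using f_img by blast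
    then show "S #>\<^bsub>\<Pi>\<^esub> (P \<otimes>\<^bsub>\<Pi>\<^esub> gen X) \<in> ?I" using f[OF P] by simp
  next
    assume "S #>\<^bsub>\<Pi>\<^esub> (P \<otimes>\<^bsub>\<Pi>\<^esub> gen X) \<in> ?I"
    then obtain v where v: "v \<in> kept_verts n A" "S #>\<^bsub>\<Pi>\<^esub> (P \<otimes>\<^bsub>\<Pi>\<^esub> gen X) = f (S #>\<^bsub>\<Pi>\<^esub> v)"
      using f_img by blast
    then have "S #>\<^bsub>\<Pi>\<^esub> P = S #>\<^bsub>\<Pi>\<^esub> v"
      using coset_mult_cancel[OF P kept_closed[OF v(1)], of "gen X"] by (simp add: f kept_closed)
    then show "S #>\<^bsub>\<Pi>\<^esub> P \<in> ?I" using v(1) by blast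
  qed
qed

section \<open>Vertices and edges of the glued graph\<close>

definition cls :: "(int^2^2) set \<Rightarrow> (int^2^2) set set" where
  "cls v = glue_equiv n A `` {v}"

lemma cls_eq_iff: "cls u = cls v \<longleftrightarrow> retract u = retract v"
  unfolding cls_def by (simp add: eq_equiv_class_iff[OF equiv_glue_equiv] glue_equiv_iff)

lemma retract_idem [simp]: "retract (retract v) = retract v"
  by (rule retract_not_leaf[OF not_leaf_retract])

lemma kept_edges_iff:
  "(u, X, v) \<in> kept_edges n A \<longleftrightarrow>
    u \<in> kept_verts n A \<and> v = u \<otimes>\<^bsub>\<Pi>\<^esub> gen X \<and> v \<in> kept_verts n A"
proof -
  have "kept_verts n A \<subseteq> double_tree_verts"
    by (auto simp: kept_verts_def double_tree_verts_def)
  then show ?thesis by (auto simp: kept_edges_def double_tree_edges_def)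
qed

text \<open>The target is computed from the retracted source, so that leaves too have an edge for
  each letter.\<close>

definition edge_T where
  "edge_T v X = (cls v, X, cls (retract v \<otimes>\<^bsub>\<Pi>\<^esub> gen X))"

text \<open>Edges become indexed by a vertex and a label; as they depend on the vertex through its
  class only, each class has one outgoing edge per label.\<close>

lemma graph_T_eq:
  "graph_T n A = triple_graph (cls ` kept_verts n A)
     {edge_T v X | v X. v \<in> kept_verts n A} (cls \<one>\<^bsub>\<Pi>\<^esub>)"
proof -
  have "kept_verts n A // glue_equiv n A = cls ` kept_verts n A"
    by (auto simp: quotient_def cls_def)
  moreover have "{(cls u, X, cls v) | u X v. (u, X, v) \<in> kept_edges n A}
      = {edge_T v X | v X. v \<in> kept_verts n A}"
  proof (intro equalityI subsetI)
    fix e assume "e \<in> {(cls u, X, cls v) | u X v. (u, X, v) \<in> kept_edges n A}"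
    then obtain u X where e: "e = (cls u, X, cls (u \<otimes>\<^bsub>\<Pi>\<^esub> gen X))"
      and u: "u \<in> kept_verts n A" "u \<otimes>\<^bsub>\<Pi>\<^esub> gen X \<in> kept_verts n A"
      unfolding kept_edges_iff by blast
    have "e = edge_T u X" using retract_mult[OF u] by (simp add: e edge_T_def cls_eq_iff)
    then show "e \<in> {edge_T v X | v X. v \<in> kept_verts n A}" using u(1) by blast
  next
    fix e assume "e \<in> {edge_T v X | v X. v \<in> kept_verts n A}"
    then obtain v X where e: "e = edge_T v X" and v: "v \<in> kept_verts n A" by blast
    have "(retract v, X, retract v \<otimes>\<^bsub>\<Pi>\<^esub> gen X) \<in> kept_edges n A"
      using v by (simp add: kept_edges_iff retract_kept kept_mult not_leaf_retract)
    moreover have "e = (cls (retract v), X, cls (retract v \<otimes>\<^bsub>\<Pi>\<^esub> gen X))"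
      by (simp add: e edge_T_def cls_eq_iff)
    ultimately show "e \<in> {(cls u, X, cls v) | u X v. (u, X, v) \<in> kept_edges n A}" by blast
  qed
  ultimately show ?thesis by (simp add: graph_T_def Let_def flip: cls_def)
qed

lemma edge_T_cong: "cls u = cls v \<Longrightarrow> edge_T u X = edge_T v X"
  by (simp add: edge_T_def cls_eq_iff)

lemma verts_T: "verts (digr (graph_T n A)) = cls ` kept_verts n A"
  and arcs_T: "arcs (digr (graph_T n A)) = {edge_T v X | v X. v \<in> kept_verts n A}"
  and ends_T: "tail (digr (graph_T n A)) (edge_T v X) = cls v"
    "head (digr (graph_T n A)) (edge_T v X) = cls (retract v \<otimes>\<^bsub>\<Pi>\<^esub> gen X)"
    "lab (graph_T n A) (edge_T v X) = X"
  and root_T: "root (graph_T n A) = cls \<one>\<^bsub>\<Pi>\<^esub>"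
  by (simp_all add: graph_T_eq triple_graph_def edge_T_def)

section \<open>The Schreier graph in matching form\<close>

definition edge_S where
  "edge_S P X = (S #>\<^bsub>\<Pi>\<^esub> P, X, S #>\<^bsub>\<Pi>\<^esub> (P \<otimes>\<^bsub>\<Pi>\<^esub> gen X))"

lemma edge_S_cong:
  "P \<in> carrier \<Pi> \<Longrightarrow> Q \<in> carrier \<Pi> \<Longrightarrow> S #>\<^bsub>\<Pi>\<^esub> P = S #>\<^bsub>\<Pi>\<^esub> Q \<Longrightarrow> edge_S P X = edge_S Q X"
  by (simp add: edge_S_def coset_mult)

lemma verts_S: "verts (digr (schreier S)) = (\<lambda>P. S #>\<^bsub>\<Pi>\<^esub> P) ` carrier \<Pi>"
  and arcs_S: "arcs (digr (schreier S)) = {edge_S P X | P X. P \<in> carrier \<Pi>}"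
  and ends_S: "tail (digr (schreier S)) (edge_S P X) = S #>\<^bsub>\<Pi>\<^esub> P"
    "head (digr (schreier S)) (edge_S P X) = S #>\<^bsub>\<Pi>\<^esub> (P \<otimes>\<^bsub>\<Pi>\<^esub> gen X)"
    "lab (schreier S) (edge_S P X) = X"
  and root_S: "root (schreier S) = S"
  by (auto simp: schreier_def triple_graph_def edge_S_def RCOSETS_def)

lemma wf_T: "wf_digraph (digr (graph_T n A))"
proof
  fix e assume "e \<in> arcs (digr (graph_T n A))"
  then obtain v X where e: "e = edge_T v X" and v: "v \<in> kept_verts n A" by (auto simp: arcs_T)
  show "tail (digr (graph_T n A)) e \<in> verts (digr (graph_T n A))"
    using v by (simp add: e ends_T verts_T)
  show "head (digr (graph_T n A)) e \<in> verts (digr (graph_T n A))"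
    using v by (simp add: e ends_T verts_T retract_kept kept_mult not_leaf_retract)
qed

lemma fin_digraph_T: "fin_digraph (digr (graph_T n A))"
proof -
  have "finite (UNIV :: label set)"
    by (rule finite_subset[of _ "{L, N, F}"]) (auto intro: label.exhaust)
  then have "finite (\<Union>v\<in>kept_verts n A. range (edge_T v))"
    using finite_kept_verts by blast
  moreover have "arcs (digr (graph_T n A)) = (\<Union>v\<in>kept_verts n A. range (edge_T v))"
    unfolding arcs_T by blast
  ultimately show ?thesis
    using wf_T finite_kept_verts
    by (simp add: fin_digraph_def fin_digraph_axioms_def verts_T)
qed

lemma wf_S: "wf_digraph (digr (schreier S))"
  by unfold_locales (auto simp: arcs_S verts_S ends_S)

section \<open>The vertex and edge maps\<close>

definition vmap :: "(int^2^2) set set \<Rightarrow> (int^2^2) set set" where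
  "vmap c = S #>\<^bsub>\<Pi>\<^esub> retract (SOME v. v \<in> c)"

definition emap where
  "emap = (\<lambda>(c, X :: label, d). (vmap c, X, vmap d))"

text \<open>All members of a class share one retraction, so the representative picked by
  \<open>SOME\<close> does not affect the coset.\<close>

lemma vmap_cls: "vmap (cls v) = S #>\<^bsub>\<Pi>\<^esub> v"
proof -
  have "v \<in> cls v" by (simp add: cls_def glue_equiv_iff)
  then have "(SOME w. w \<in> cls v) \<in> cls v" by (rule someI)
  then have "retract (SOME w. w \<in> cls v) = retract v" by (simp add: cls_def glue_equiv_iff)
  then show ?thesis by (simp add: vmap_def coset_retract)
qed

lemma emap_edge_T: "v \<in> kept_verts n A \<Longrightarrow> emap (edge_T v X) = edge_S v X"
  using edge_S_cong[of "retract v" v X]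
  by (simp add: emap_def edge_T_def edge_S_def vmap_cls coset_retract kept_closed retract_kept)

lemma out_arcs_T:
  assumes "v \<in> kept_verts n A"
  shows "out_arcs (digr (graph_T n A)) (cls v) = range (edge_T v)"
proof -
  have "edge_T u X \<in> range (edge_T v)" if "cls u = cls v" for u X
    unfolding edge_T_cong[OF that] by (rule rangeI)
  then show ?thesis using assms unfolding out_arcs_def arcs_T by (auto simp: ends_T)
qed

lemma out_arcs_S:
  assumes "P \<in> carrier \<Pi>"
  shows "out_arcs (digr (schreier S)) (S #>\<^bsub>\<Pi>\<^esub> P) = range (edge_S P)"
proof -
  have "edge_S Q X \<in> range (edge_S P)" if "Q \<in> carrier \<Pi>" "S #>\<^bsub>\<Pi>\<^esub> Q = S #>\<^bsub>\<Pi>\<^esub> P" for Q X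
    unfolding edge_S_cong[OF that(1) assms that(2)] by (rule rangeI)
  then show ?thesis using assms unfolding out_arcs_def arcs_S by (auto simp: ends_S)
qed

lemma vmap_verts: "vmap ` verts (digr (graph_T n A)) = verts (digr (schreier S))"
proof -
  have "vmap ` verts (digr (graph_T n A)) = (\<lambda>v. S #>\<^bsub>\<Pi>\<^esub> v) ` kept_verts n A"
    by (simp add: verts_T image_image vmap_cls)
  also have "\<dots> = verts (digr (schreier S))"
    unfolding verts_S using coset_kept kept_closed by blast
  finally show ?thesis .
qed

text \<open>Surjectivity rests on \<open>coset_kept\<close>: the source of any Schreier edge is the
  coset of a kept vertex, which has an edge with the same label.\<close>

lemma emap_arcs: "emap ` arcs (digr (graph_T n A)) = arcs (digr (schreier S))"
proof (intro equalityI subsetI)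
  fix e assume "e \<in> emap ` arcs (digr (graph_T n A))"
  then obtain v X where "e = emap (edge_T v X)" "v \<in> kept_verts n A" unfolding arcs_T by blast
  then have "e = edge_S v X" "v \<in> carrier \<Pi>" by (simp_all add: emap_edge_T kept_closed)
  then show "e \<in> arcs (digr (schreier S))" unfolding arcs_S by blast
next
  fix e assume "e \<in> arcs (digr (schreier S))"
  then obtain P X where P: "P \<in> carrier \<Pi>" "e = edge_S P X" by (auto simp: arcs_S)
  then obtain v where v: "v \<in> kept_verts n A" "S #>\<^bsub>\<Pi>\<^esub> P = S #>\<^bsub>\<Pi>\<^esub> v" using coset_kept by blast
  then have "e = emap (edge_T v X)"
    using P edge_S_cong[OF P(1) kept_closed[OF v(1)] v(2)] by (simp add: emap_edge_T)
  then show "e \<in> emap ` arcs (digr (graph_T n A))" using v(1) by (auto simp: arcs_T)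
qed

lemma opfibration_T: "opfibration (graph_T n A) (schreier S) vmap emap"
proof -
  have "rooted_lgraph (graph_T n A)"
    using wf_T one_kept by (simp add: rooted_lgraph_def root_T verts_T)
  moreover have "rooted_lgraph (schreier S)"
    using wf_S coset_one PGL2Z.one_closed by (force simp: rooted_lgraph_def root_S verts_S)
  moreover have "tail (digr (schreier S)) (emap e) = vmap (tail (digr (graph_T n A)) e)
      \<and> head (digr (schreier S)) (emap e) = vmap (head (digr (graph_T n A)) e)
      \<and> lab (schreier S) (emap e) = lab (graph_T n A) e"
    if "e \<in> arcs (digr (graph_T n A))" for e
  proof -
    obtain v X where e: "e = edge_T v X" and v: "v \<in> kept_verts n A" using \<open>e \<in> _\<close> by (auto simp: arcs_T)
    have "S #>\<^bsub>\<Pi>\<^esub> (v \<otimes>\<^bsub>\<Pi>\<^esub> gen X) = S #>\<^bsub>\<Pi>\<^esub> (retract v \<otimes>\<^bsub>\<Pi>\<^esub> gen X)"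
      using v by (simp add: coset_mult kept_closed retract_kept coset_retract)
    then show ?thesis using v by (simp add: e emap_edge_T ends_T ends_S vmap_cls)
  qed
  moreover have "bij_betw emap (out_arcs (digr (graph_T n A)) c) (out_arcs (digr (schreier S)) (vmap c))"
    if "c \<in> verts (digr (graph_T n A))" for c
  proof -
    obtain v where c: "c = cls v" and v: "v \<in> kept_verts n A" using \<open>c \<in> _\<close> by (auto simp: verts_T)
    \<comment> \<open>Edges leaving one vertex are told apart by their labels, and
      \<open>emap\<close> keeps labels.\<close>
    have "inj_on emap (range (edge_T v))"
      by (rule inj_onI) (auto simp: emap_def edge_T_def)
    moreover have "emap ` range (edge_T v) = range (edge_S v)"
      using v by (simp add: image_image emap_edge_T)
    ultimately show ?thesis
      using v by (simp add: bij_betw_def c vmap_cls out_arcs_T out_arcs_S kept_closed)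
  qed
  moreover have "vmap (root (graph_T n A)) = root (schreier S)"
    by (simp add: root_T root_S vmap_cls coset_one)
  ultimately show ?thesis
    unfolding opfibration_def lgraph_hom_def using vmap_verts emap_arcs by simp
qed

lemma finite_rcosets: "finite (rcosets\<^bsub>\<Pi>\<^esub> S)"
proof -
  have "rcosets\<^bsub>\<Pi>\<^esub> S \<subseteq> (\<lambda>v. S #>\<^bsub>\<Pi>\<^esub> v) ` kept_verts n A"
    using coset_kept by (auto simp: RCOSETS_def)
  then show ?thesis using finite_kept_verts finite_subset by blast
qed

end

theorem theorem3p2:
  fixes n :: nat and A :: "nat \<Rightarrow> (int^2^2) set"
  assumes "slow_cf n A"
  shows "(\<exists>\<phi> \<psi>. opfibration (graph_T n A) (schreier (Sigma_T n A)) \<phi> \<psi>)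
    \<and> fin_digraph (digr (graph_T n A))
    \<and> finite (rcosets\<^bsub>\<Pi>\<^esub> (Sigma_T n A))"
proof -
  interpret slow_cf_algorithm n A by unfold_locales (rule assms)
  show ?thesis using opfibration_T fin_digraph_T finite_rcosets by blast
qed

end
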